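(* Let $k\mid n$. A set $\Pi$ of affine points of $\Sigma=\mathrm{PG}(2n,q)$ is the image under $\phi$ of the set of affine points of an $\mathbb{F}_{q^k}$-subplane of $\mathrm{PG}(2,q^n)$ secant to $l_\infty$ if and only if (i) $\Pi$ is a $2k$-dimensional affine subspace, and (ii) $\bar\Pi\cap H_\infty$ is a $(2k-1)$-dimensional subspace meeting exactly $q^k+1$ elements of $\mathcal D$, each in a $(k-1)$-dimensional subspace. Moreover, in that case $\bar\Pi\cap H_\infty$ meets each of these $q^k+1$ elements of $\mathcal D$ in an element of $\mathcal D_k$.
   Context: Let $q$ be a prime power and $n\ge1$. Points of $\mathrm{PG}(2,q^n)$ are written $(a,b,c)_{\mathbb{F}_{q^n}}$; $l_\infty$ is the line $c=0$; points off $l_\infty$ are affine. For $k\mid n$, an $\mathbb{F}_{q^k}$-subplane is a set $\{(su+tv+wz)_{\mathbb{F}_{q^n}}:(s,t,w)\in\mathbb{F}_{q^k}^3\setminus\{0\}\}$ for $\mathbb{F}_{q^n}$-independent $u,v,z\in\mathbb{F}_{q^n}^3$; it is secant to $l_\infty$ if it meets $l_\infty$ in $q^k+1$ points. Let $\Sigma=\mathrm{PG}(2n,q)$ be the projective space of the $\mathbb{F}_q$-vector space $\mathbb{F}_{q^n}\times\mathbb{F}_{q^n}\times\mathbb{F}_q$, points $(a,b,c)_{\mathbb{F}_q}$; $H_\infty$ is the hyperplane $c=0$, points off it are affine. An affine subspace is the set of affine points of a projective subspace not contained in $H_\infty$, with projective completion $\bar\Pi$. For $k\mid n$, $\mathcal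 D_k=\{\{(ax,bx,0)_{\mathbb{F}_q}:x\in\mathbb{F}_{q^k}^*\}:(a,b)\in\mathbb{F}_{q^n}^2\setminus\{(0,0)\}\}$, $\mathcal D=\mathcal D_n$. The ABB-map $\phi$ sends an affine point $(a,b,1)_{\mathbb{F}_{q^n}}$ to $(a,b,1)_{\mathbb{F}_q}$. *)

theory Defs
  imports Main "HOL-Library.Product_Plus" "HOL-Computational_Algebra.Primes"
begin

(* Vectors of F_{q^n}^3 (the ambient field is a finite field type 'f). *)
type_synonym 'f vec3 = "'f \<times> 'f \<times> 'f"

definition smult :: "'f::field \<Rightarrow> 'f vec3 \<Rightarrow> 'f vec3" where
  "smult t v = (case v of (a, b, c) \<Rightarrow> (t * a, t * b, t * c))"

(* The subfield of order m inside the finite field 'f: {x. x^m = x}.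
   subF q = F_q, subF (q^k) = F_{q^k}, and subF (q^n) = whole field. *)
definition subF :: "nat \<Rightarrow> 'f::field set" where
  "subF m = {x. x ^ m = x}"

definition lin_span :: "'f::field set \<Rightarrow> 'f vec3 set \<Rightarrow> 'f vec3 set" where
  "lin_span K S = {(\<Sum>v\<in>T. smult (c v) v) | T c. finite T \<and> T \<subseteq> S \<and> (\<forall>v\<in>T. c v \<in> K)}"

definition lin_indep :: "'f::field set \<Rightarrow> 'f vec3 set \<Rightarrow> bool" where
  "lin_indep K S \<longleftrightarrow> (\<forall>T c. finite T \<and> T \<subseteq> S \<and> (\<forall>v\<in>T. c v \<in> K)
       \<and> (\<Sum>v\<in>T. smult (c v) v) = 0 \<longrightarrow> (\<forall>v\<in>T. c v = 0))"

definition subspace_dim :: "'f::field set \<Rightarrow> 'f vec3 set \<Rightarrow> nat \<Rightarrow> bool" where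
  "subspace_dim K W d \<longleftrightarrow>
     (\<exists>B. finite B \<and> card B = d \<and> lin_indep K B \<and> lin_span K B = W)"

definition proj_pt :: "'f::field set \<Rightarrow> 'f vec3 \<Rightarrow> 'f vec3 set" where
  "proj_pt K v = {smult t v | t. t \<in> K \<and> t \<noteq> 0}"

definition pts :: "'f::field set \<Rightarrow> 'f vec3 set \<Rightarrow> 'f vec3 set set" where
  "pts K W = {proj_pt K v | v. v \<in> W \<and> v \<noteq> 0}"

(* ---------- Sigma = PG(2n,q), underlying F_q-space F_{q^n} x F_{q^n} x F_q ---------- *)
definition Vsig :: "nat \<Rightarrow> 'f::field vec3 set" where
  "Vsig q = {(a, b, c). c \<in> subF q}"

definition Hinf :: "'f::field vec3 set" where
  "Hinf = {(a, b, c). c = 0}"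

definition sig_aff_pts :: "nat \<Rightarrow> 'f::field vec3 set set" where
  "sig_aff_pts q = {proj_pt (subF q) (a, b, c) | a b c. c \<in> subF q \<and> c \<noteq> 0}"

definition aff_part :: "nat \<Rightarrow> 'f::field vec3 set \<Rightarrow> 'f vec3 set set" where
  "aff_part q W = pts (subF q) W \<inter> sig_aff_pts q"

(* D_k; D = D_n *)
definition Dk :: "nat \<Rightarrow> nat \<Rightarrow> 'f::field vec3 set set set" where
  "Dk q k = {{proj_pt (subF q) (a * x, b * x, 0) | x. x \<in> subF (q ^ k) \<and> x \<noteq> 0}
             | a b. (a, b) \<noteq> (0, 0)}"

definition plane_aff_pts :: "'f::field vec3 set set" where
  "plane_aff_pts = {proj_pt UNIV (a, b, c) | a b c. c \<noteq> 0}"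

definition linf :: "'f::field vec3 set set" where
  "linf = {proj_pt UNIV (a, b, 0) | a b. (a, b) \<noteq> (0, 0)}"

definition subplane :: "nat \<Rightarrow> nat \<Rightarrow> 'f::field vec3 set set \<Rightarrow> bool" where
  "subplane q k B \<longleftrightarrow> (\<exists>u v z.
     (\<forall>s t w. smult s u + smult t v + smult w z = 0 \<longrightarrow> s = 0 \<and> t = 0 \<and> w = 0) \<and>
     B = {proj_pt UNIV (smult s u + smult t v + smult w z) | s t w.
            s \<in> subF (q ^ k) \<and> t \<in> subF (q ^ k) \<and> w \<in> subF (q ^ k) \<and> (s, t, w) \<noteq> (0, 0, 0)})"

definition secant :: "nat \<Rightarrow> nat \<Rightarrow> 'f::field vec3 set set \<Rightarrow> bool" where
  "secant q k B \<longleftrightarrow> card (B \<inter> linf) = q ^ k + 1"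

definition phi :: "nat \<Rightarrow> 'f::field vec3 set \<Rightarrow> 'f vec3 set" where
  "phi q P = proj_pt (subF q) (SOME v. v \<in> P \<and> snd (snd v) = 1)"

end

theory Submission
  imports "HOL-Computational_Algebra.Polynomial" "HOL-Library.FuncSet" Defs
begin

text \<open>Let \<open>F\<close> be the big field. The part at infinity \<open>M\<close> of an affine subspace satisfying (i) and (ii)
  is an additive subgroup of \<open>F \<times> F\<close> of size \<open>q ^ (2 * k)\<close> such that each nonzero \<open>v \<in> M\<close> has exactly
  \<open>q ^ k\<close> multiples \<open>x v\<close>, \<open>x \<in> F\<close>, in \<open>M\<close>. For independent \<open>u, v \<in> M\<close> the sets of admissible scalars
  of \<open>u\<close>, \<open>v\<close> and \<open>u + v\<close> coincide, and comparison with \<open>a u + v\<close> shows that this common set is the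
  subfield of order \<open>q ^ k\<close>; hence \<open>M\<close> is the subfield span of \<open>u\<close> and \<open>v\<close>. The same argument applies
  to the part at infinity of a subplane, whose size is determined by secancy. So both sides of the
  equivalence say that \<open>\<Pi>\<close> consists of the points of \<open>a + z\<close>, where \<open>a\<close> ranges over the subfield span
  of independent \<open>u, v\<close> at infinity and \<open>z\<close> has last coordinate \<open>1\<close>. Dimensions are recognised by
  counting elements.\<close>

section \<open>Vectors and subspaces\<close>

notation Defs.smult (infixr "\<cdot>" 75)

lemma smult_Pair [simp]: "t \<cdot> (a, b, c) = (t * a, t * b, t * c)"
  by (simp add: Defs.smult_def)

lemma smult_add_right: "t \<cdot> (u + v) = t \<cdot> u + t \<cdot> v"
  by (cases u; cases v) (simp add: algebra_simps)

lemma smult_add_left: "(s + t) \<cdot> v = s \<cdot> v + t \<cdot> v"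
  by (cases v) (simp add: algebra_simps)

lemma smult_diff_left: "(s - t) \<cdot> v = s \<cdot> v - t \<cdot> v"
  by (cases v) (simp add: algebra_simps)

lemma smult_smult [simp]: "s \<cdot> t \<cdot> v = (s * t) \<cdot> v"
  by (cases v) (simp add: algebra_simps)

lemma smult_0_left [simp]: "0 \<cdot> v = 0"
  by (cases v) (simp add: zero_prod_def)

lemma smult_0_right [simp]: "t \<cdot> 0 = 0"
  by (simp add: zero_prod_def)

lemma smult_1 [simp]: "1 \<cdot> v = v"
  by (cases v) simp

lemma smult_minus_left: "(- t) \<cdot> v = - (t \<cdot> v)"
  by (cases v) simp

lemma smult_eq_0_iff [simp]: "t \<cdot> v = 0 \<longleftrightarrow> t = 0 \<or> v = 0"
  by (cases v) (auto simp: zero_prod_def)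

lemma smult_cancel_right: "s \<cdot> v = t \<cdot> v \<longleftrightarrow> s = t \<or> v = 0"
  by (cases v) (auto simp: zero_prod_def)

lemma inj_smult_left: "v \<noteq> 0 \<Longrightarrow> inj_on (\<lambda>x. x \<cdot> v) A"
  by (simp add: inj_on_def smult_cancel_right)

lemma smult_sum_right: "t \<cdot> (\<Sum>v\<in>B. f v) = (\<Sum>v\<in>B. t \<cdot> f v)"
  by (induction B rule: infinite_finite_induct) (simp_all add: smult_add_right)

lemma snd_snd_smult [simp]: "snd (snd (t \<cdot> v)) = t * snd (snd v)"
  by (cases v) simp

lemma Hinf_iff: "v \<in> Hinf \<longleftrightarrow> snd (snd v) = 0"
  by (cases v) (simp add: Hinf_def)

lemma Vsig_iff: "v \<in> Vsig q \<longleftrightarrow> snd (snd v) \<in> subF q"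
  by (cases v) (simp add: Vsig_def)

definition lsub :: "'f::field set \<Rightarrow> 'f vec3 set \<Rightarrow> bool" where
  "lsub K W \<longleftrightarrow> 0 \<in> W \<and> (\<forall>u\<in>W. \<forall>v\<in>W. u + v \<in> W) \<and> (\<forall>t\<in>K. \<forall>v\<in>W. t \<cdot> v \<in> W)"

lemma lsub_0: "lsub K W \<Longrightarrow> 0 \<in> W"
  and lsub_add: "lsub K W \<Longrightarrow> u \<in> W \<Longrightarrow> v \<in> W \<Longrightarrow> u + v \<in> W"
  and lsub_smult: "lsub K W \<Longrightarrow> t \<in> K \<Longrightarrow> v \<in> W \<Longrightarrow> t \<cdot> v \<in> W"
  by (auto simp: lsub_def)

lemma lsub_sum:
  assumes "lsub K W" "\<And>v. v \<in> B \<Longrightarrow> f v \<in> W"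
  shows "(\<Sum>v\<in>B. f v) \<in> W"
  using assms(2)
  by (induction B rule: infinite_finite_induct) (auto intro: lsub_0 lsub_add assms(1))

lemma lsub_mono: "lsub K W \<Longrightarrow> L \<subseteq> K \<Longrightarrow> lsub L W"
  by (auto simp: lsub_def)

lemma lsub_Int_Hinf: "lsub K W \<Longrightarrow> lsub K (W \<inter> Hinf)"
  by (auto simp: lsub_def Hinf_iff)

locale finite_subfield =
  fixes K :: "'f::{field,finite} set"
  assumes one: "1 \<in> K"
    and diff: "x \<in> K \<Longrightarrow> y \<in> K \<Longrightarrow> x - y \<in> K"
    and mult: "x \<in> K \<Longrightarrow> y \<in> K \<Longrightarrow> x * y \<in> K"
    and inverse: "x \<in> K \<Longrightarrow> inverse x \<in> K"
begin

lemma zero: "0 \<in> K"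
  using diff[OF one one] by simp

lemma uminus: "x \<in> K \<Longrightarrow> - x \<in> K"
  using diff[OF zero, of x] by simp

lemma add: "x \<in> K \<Longrightarrow> y \<in> K \<Longrightarrow> x + y \<in> K"
  using diff[OF _ uminus[of y], of x] by simp

lemma divide: "x \<in> K \<Longrightarrow> y \<in> K \<Longrightarrow> x / y \<in> K"
  by (simp add: mult inverse divide_inverse)

lemma mult_cancel: "x * s \<in> K \<Longrightarrow> s \<in> K \<Longrightarrow> s \<noteq> 0 \<Longrightarrow> x \<in> K"
  using divide[of "x * s" s] by simp

lemma lsub_diff: "lsub K W \<Longrightarrow> u \<in> W \<Longrightarrow> v \<in> W \<Longrightarrow> u - v \<in> W"
  using lsub_add[of K W u "- v"] lsub_smult[of K W "- 1" v] uminus[OF one]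
  by (simp add: smult_minus_left)

lemma card_gt_1: "card K > 1"
proof -
  have "card {0, 1 :: 'f} \<le> card K"
    by (rule card_mono) (auto simp: zero one)
  then show ?thesis by simp
qed

lemma lin_span_altdef:
  assumes "finite B"
  shows "lin_span K B = (\<lambda>c. \<Sum>v\<in>B. c v \<cdot> v) ` (B \<rightarrow>\<^sub>E K)"
proof (intro equalityI subsetI)
  fix w assume "w \<in> lin_span K B"
  then obtain T c where T: "T \<subseteq> B" "\<forall>v\<in>T. c v \<in> K" "w = (\<Sum>v\<in>T. c v \<cdot> v)"
    by (auto simp: lin_span_def)
  define c' where "c' = (\<lambda>v\<in>B. if v \<in> T then c v else 0)"
  have "(\<Sum>v\<in>T. c v \<cdot> v) = (\<Sum>v\<in>B. c' v \<cdot> v)"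
    using T(1) assms by (intro sum.mono_neutral_cong_left) (auto simp: c'_def)
  moreover have "c' \<in> B \<rightarrow>\<^sub>E K"
    using T(2) zero by (auto simp: c'_def)
  ultimately show "w \<in> (\<lambda>c. \<Sum>v\<in>B. c v \<cdot> v) ` (B \<rightarrow>\<^sub>E K)"
    using T(3) by blast
next
  fix w assume "w \<in> (\<lambda>c. \<Sum>v\<in>B. c v \<cdot> v) ` (B \<rightarrow>\<^sub>E K)"
  then obtain c where "c \<in> B \<rightarrow>\<^sub>E K" "w = (\<Sum>v\<in>B. c v \<cdot> v)"
    by blast
  then show "w \<in> lin_span K B"
    unfolding lin_span_def using assms by blast
qed

lemma lin_indep_altdef:
  assumes "finite B"
  shows "lin_indep K B \<longleftrightarrow>
    (\<forall>c. (\<forall>v\<in>B. c v \<in> K) \<and> (\<Sum>v\<in>B. c v \<cdot> v) = 0 \<longrightarrow> (\<forall>v\<in>B. c v = 0))" (is "_ \<longleftrightarrow> ?R")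
proof
  assume "lin_indep K B"
  then show ?R unfolding lin_indep_def using assms by blast
next
  assume R: ?R
  show "lin_indep K B" unfolding lin_indep_def
  proof (intro allI impI)
    fix T c assume T: "finite T \<and> T \<subseteq> B \<and> (\<forall>v\<in>T. c v \<in> K) \<and> (\<Sum>v\<in>T. c v \<cdot> v) = 0"
    define c' where "c' = (\<lambda>v. if v \<in> T then c v else 0)"
    have "(\<Sum>v\<in>T. c v \<cdot> v) = (\<Sum>v\<in>B. c' v \<cdot> v)"
      using T assms by (intro sum.mono_neutral_cong_left) (auto simp: c'_def)
    moreover have "\<forall>v\<in>B. c' v \<in> K"
      using T zero by (simp add: c'_def)
    ultimately have "\<forall>v\<in>B. c' v = 0"
      using R T by simp
    then show "\<forall>v\<in>T. c v = 0" using T by (metis c'_def subsetD)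
  qed
qed

lemma lsub_lin_span:
  assumes "finite B"
  shows "lsub K (lin_span K B)"
  unfolding lsub_def
proof (intro conjI ballI)
  have *: "(\<Sum>v\<in>B. c v \<cdot> v) \<in> lin_span K B" if "\<And>v. v \<in> B \<Longrightarrow> c v \<in> K" for c
    unfolding lin_span_def using assms that by blast
  show "0 \<in> lin_span K B"
    using *[of "\<lambda>_. 0"] by (simp add: zero)
  fix u assume "u \<in> lin_span K B"
  then obtain c where c: "c \<in> B \<rightarrow>\<^sub>E K" "u = (\<Sum>v\<in>B. c v \<cdot> v)"
    unfolding lin_span_altdef[OF assms] by blast
  {
    fix w assume "w \<in> lin_span K B"
    then obtain d where d: "d \<in> B \<rightarrow>\<^sub>E K" "w = (\<Sum>v\<in>B. d v \<cdot> v)"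
      unfolding lin_span_altdef[OF assms] by blast
    have "u + w = (\<Sum>v\<in>B. (c v + d v) \<cdot> v)"
      by (simp add: c d sum.distrib smult_add_left)
    moreover have "\<dots> \<in> lin_span K B"
      using c(1) d(1) by (intro *) (auto intro: add)
    ultimately show "u + w \<in> lin_span K B" by simp
  }
  fix t assume "t \<in> K"
  then have "(\<Sum>v\<in>B. (t * c v) \<cdot> v) \<in> lin_span K B"
    using c(1) by (intro *) (auto intro: mult)
  then show "t \<cdot> u \<in> lin_span K B"
    by (simp add: c smult_sum_right)
qed

lemma card_lin_span:
  assumes "finite B" "lin_indep K B"
  shows "card (lin_span K B) = card K ^ card B"
proof -
  have "inj_on (\<lambda>c. \<Sum>v\<in>B. c v \<cdot> v) (B \<rightarrow>\<^sub>E K)"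
  proof (rule inj_onI)
    fix c d assume cd: "c \<in> B \<rightarrow>\<^sub>E K" "d \<in> B \<rightarrow>\<^sub>E K" "(\<Sum>v\<in>B. c v \<cdot> v) = (\<Sum>v\<in>B. d v \<cdot> v)"
    have "(\<Sum>v\<in>B. (c v - d v) \<cdot> v) = 0"
      using cd(3) by (simp add: smult_diff_left sum_subtractf)
    then have "\<forall>v\<in>B. c v - d v = 0"
      using assms cd(1,2) unfolding lin_indep_altdef[OF assms(1)]
      by (auto intro!: diff dest!: spec[of _ "\<lambda>v. c v - d v"])
    then show "c = d"
      using cd(1,2) by (intro PiE_ext[of c B "\<lambda>_. K"]) auto
  qed
  then show ?thesis
    using assms(1) by (simp add: lin_span_altdef card_image card_PiE)
qed

lemma lsub_has_basis:
  assumes W: "lsub K W"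
  shows "\<exists>B. finite B \<and> lin_indep K B \<and> lin_span K B = W"
proof -
  define S where "S = {B. B \<subseteq> W \<and> lin_indep K B}"
  have "{} \<in> S" by (simp add: S_def lin_indep_def)
  then obtain B where B: "B \<in> S" and max: "\<And>B'. B' \<in> S \<Longrightarrow> B \<subseteq> B' \<Longrightarrow> B = B'"
    using finite_has_maximal[of S] by (metis empty_iff finite)
  have BW: "B \<subseteq> W" and ind: "lin_indep K B" using B by (auto simp: S_def)
  have "w \<in> lin_span K B" if "w \<in> W" for w
  proof (rule ccontr)
    assume w: "w \<notin> lin_span K B"
    have span: "(\<Sum>v\<in>B. c v \<cdot> v) \<in> lin_span K B" if "\<And>v. v \<in> B \<Longrightarrow> c v \<in> K" for c
      unfolding lin_span_def using that finite by blast
    have "w \<notin> B"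
    proof
      assume "w \<in> B"
      have eq: "(\<Sum>v\<in>B. (if v = w then 1 else 0) \<cdot> v) = w"
        using \<open>w \<in> B\<close> by (subst sum.remove[of _ w]) auto
      then show False
        using w span[of "\<lambda>v. if v = w then 1 else 0"] by (metis zero one)
    qed
    have "lin_indep K (insert w B)"
      unfolding lin_indep_altdef[OF finite]
    proof (intro allI impI)
      fix c assume c: "(\<forall>v\<in>insert w B. c v \<in> K) \<and> (\<Sum>v\<in>insert w B. c v \<cdot> v) = 0"
      have eq: "c w \<cdot> w + (\<Sum>v\<in>B. c v \<cdot> v) = 0"
        using c \<open>w \<notin> B\<close> by simp
      have "c w = 0"
      proof (rule ccontr)
        assume nz: "c w \<noteq> 0"
        have "(\<Sum>v\<in>B. c v \<cdot> v) = (- c w) \<cdot> w"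
          using eq by (simp add: smult_minus_left eq_neg_iff_add_eq_0 add.commute)
        then have "w = (- 1 / c w) \<cdot> (\<Sum>v\<in>B. c v \<cdot> v)"
          using nz by simp
        also have "\<dots> \<in> lin_span K B"
          using c by (intro lsub_smult[OF lsub_lin_span] span) (auto intro: divide one uminus)
        finally show False using w by simp
      qed
      then show "\<forall>v\<in>insert w B. c v = 0"
        using eq c ind unfolding lin_indep_altdef[OF finite] by auto
    qed
    then have "insert w B \<in> S" using BW that by (simp add: S_def)
    then show False using max[of "insert w B"] \<open>w \<notin> B\<close> by blast
  qed
  moreover have "lin_span K B \<subseteq> W"
  proof
    fix w assume "w \<in> lin_span K B"
    then obtain T c where "T \<subseteq> B" "\<forall>v\<in>T. c v \<in> K" "w = (\<Sum>v\<in>T. c v \<cdot> v)"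
      by (auto simp: lin_span_def)
    moreover have "(\<Sum>v\<in>T. c v \<cdot> v) \<in> W"
      using BW \<open>T \<subseteq> B\<close> \<open>\<forall>v\<in>T. c v \<in> K\<close> by (blast intro: lsub_sum[OF W] lsub_smult[OF W])
    ultimately show "w \<in> W" by simp
  qed
  ultimately show ?thesis using ind by (metis finite subset_antisym subsetI)
qed

lemma subspace_dim_iff: "subspace_dim K W d \<longleftrightarrow> lsub K W \<and> card W = card K ^ d"
  unfolding subspace_dim_def
  using lsub_has_basis[of W] lsub_lin_span card_lin_span card_gt_1
  by (metis power_inject_exp)

end

lemma power_card_of_mult_closed:
  fixes A :: "'f::{field,finite} set"
  assumes mult: "\<And>x y. x \<in> A \<Longrightarrow> y \<in> A \<Longrightarrow> x * y \<in> A" and "0 \<in> A" "x \<in> A"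
  shows "x ^ card A = x"
proof (cases "x = 0")
  case True
  then show ?thesis using \<open>0 \<in> A\<close> by (auto simp: zero_power card_gt_0_iff)
next
  case False
  have "(\<lambda>y. x * y) ` (A - {0}) = A - {0}"
    using False assms by (intro card_subset_eq) (auto simp: card_image inj_on_def)
  then have "(\<Prod>y\<in>A-{0}. y) = (\<Prod>y\<in>(\<lambda>y. x * y) ` (A - {0}). y)"
    by simp
  also have "\<dots> = (\<Prod>y\<in>A-{0}. x * y)"
    using False by (subst prod.reindex) (auto simp: inj_on_def)
  also have "\<dots> = x ^ card (A - {0}) * (\<Prod>y\<in>A-{0}. y)"
    by (simp add: prod.distrib)
  finally have "x ^ card (A - {0}) = 1"
    by simp
  moreover have "card A = Suc (card (A - {0}))"
    using \<open>0 \<in> A\<close> by (metis card_Suc_Diff1 finite)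
  ultimately show ?thesis by simp
qed

section \<open>Subfields of a finite field\<close>

lemma prime_char_of_card:
  assumes "prime p" "card (UNIV :: 'f::{field,finite} set) = p ^ e"
  shows "CHAR('f) = p"
proof -
  have "(\<Sum>x\<in>(UNIV::'f set). x + 1) = (\<Sum>x\<in>UNIV. x)"
    by (rule sum.reindex_bij_witness[of _ "\<lambda>x. x - 1" "\<lambda>x. x + 1"]) auto
  then have "of_nat (card (UNIV :: 'f set)) = (0 :: 'f)"
    by (simp add: sum.distrib)
  then have "of_nat p = (0 :: 'f)"
    using assms(2) by simp
  then have "CHAR('f) dvd p"
    by (simp add: of_nat_eq_0_iff_char_dvd)
  then have "CHAR('f) = 1 \<or> CHAR('f) = p"
    using assms(1) unfolding prime_nat_iff by blast
  then show ?thesis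
    using CHAR_not_1'[where 'a = 'f] by simp
qed

lemma finite_subfield_subF:
  assumes "prime p" "CHAR('f::{field,finite}) = p" "Q = p ^ e"
  shows "finite_subfield (subF Q :: 'f set)"
proof
  have Q: "Q > 0" using assms by (simp add: prime_gt_0_nat)
  have add: "(x + y) ^ Q = x ^ Q + y ^ Q" for x y :: 'f
    using freshmans_dream'[where 'a = 'f] assms by blast
  show "1 \<in> (subF Q :: 'f set)" by (simp add: subF_def)
  show "x - y \<in> subF Q" if "x \<in> subF Q" "y \<in> subF Q" for x y :: 'f
    using add[of "x - y" y] that by (simp add: subF_def eq_diff_eq)
  show "x * y \<in> subF Q" if "x \<in> subF Q" "y \<in> subF Q" for x y :: 'f
    using that by (simp add: subF_def power_mult_distrib)
  show "inverse x \<in> subF Q" if "x \<in> subF Q" for x :: 'f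
    using that by (simp add: subF_def power_inverse)
qed

lemma card_roots_of_unity_le:
  assumes "r > 0"
  shows "card {x::'f::{field,finite}. x ^ r = 1} \<le> r"
proof -
  have nz: "Polynomial.monom 1 r - 1 \<noteq> (0 :: 'f poly)"
    using assms by (metis degree_1 degree_monom_eq eq_iff_diff_eq_0 less_numeral_extra(3) zero_neq_one)
  have "card {x::'f. poly (Polynomial.monom 1 r - 1) x = 0} \<le> degree (Polynomial.monom 1 r - 1 :: 'f poly)"
    by (rule card_poly_roots_bound[OF nz])
  also have "\<dots> \<le> r"
    by (rule degree_diff_le) (auto simp: degree_monom_le)
  finally show ?thesis by (simp add: poly_monom)
qed

text \<open>In a field with \<open>r * s + 1\<close> elements, \<open>X ^ (r * s) - 1\<close> has \<open>r * s\<close> roots and its cofactor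
  \<open>(X ^ (r * s) - 1) / (X ^ r - 1)\<close> accounts for at most \<open>r * (s - 1)\<close> of them.\<close>

lemma card_roots_of_unity:
  assumes card: "card (UNIV :: 'f::{field,finite} set) = r * s + 1" and "r > 0"
  shows "card {x::'f. x ^ r = 1} = r"
proof (rule antisym)
  show "card {x::'f. x ^ r = 1} \<le> r"
    by (rule card_roots_of_unity_le) fact
  have s: "s > 0"
  proof (rule ccontr)
    assume "\<not> s > 0"
    then have "card (UNIV :: 'f set) = 1" using card by simp
    then obtain a :: 'f where "UNIV = {a}" by (auto simp: card_1_singleton_iff)
    then show False by (metis UNIV_I singletonD zero_neq_one)
  qed
  define g :: "'f poly" where "g = (\<Sum>i<s. Polynomial.monom 1 (r * i))"
  have cf: "coeff g 0 = 1"
  proof -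
    have "coeff g 0 = (\<Sum>i<s. if i = 0 then 1 else 0)"
      using \<open>r > 0\<close> by (simp add: g_def coeff_sum)
    then show ?thesis using s by (simp add: sum.delta')
  qed
  then have "g \<noteq> 0" by auto
  have "degree g \<le> r * (s - 1)"
    unfolding g_def
    by (rule degree_sum_le) (auto intro!: order.trans[OF degree_monom_le] mult_le_mono2)
  then have cg: "card {x. poly g x = 0} \<le> r * (s - 1)"
    using card_poly_roots_bound[OF \<open>g \<noteq> 0\<close>] by linarith
  have "UNIV - {0} \<subseteq> {x::'f. x ^ r = 1} \<union> {x. poly g x = 0}"
  proof (intro subsetI)
    fix x :: 'f assume "x \<in> UNIV - {0}"
    moreover have "x ^ (r * s + 1) = x"
      using power_card_of_mult_closed[of UNIV x] card by simp
    ultimately have "(x ^ r) ^ s = 1"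
      by (simp add: power_mult)
    moreover have "poly g x = (\<Sum>i<s. (x ^ r) ^ i)"
      by (simp add: g_def poly_sum poly_monom power_mult)
    ultimately have "(x ^ r - 1) * poly g x = 0"
      by (simp add: power_diff_1_eq[symmetric])
    then show "x \<in> {x::'f. x ^ r = 1} \<union> {x. poly g x = 0}"
      by auto
  qed
  then have "card (UNIV - {0 :: 'f}) \<le> card ({x::'f. x ^ r = 1} \<union> {x. poly g x = 0})"
    by (intro card_mono) auto
  also have "\<dots> \<le> card {x::'f. x ^ r = 1} + card {x. poly g x = 0}"
    by (rule card_Un_le)
  also have "\<dots> \<le> card {x::'f. x ^ r = 1} + r * (s - 1)"
    using cg by simp
  finally show "r \<le> card {x::'f. x ^ r = 1}"
    using card s by (cases s) (simp_all add: card_Diff_subset)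
qed

lemma card_subF:
  assumes "card (UNIV :: 'f::{field,finite} set) = Q ^ d" "Q > 1"
  shows "card (subF Q :: 'f set) = Q"
proof -
  define r where "r = Q - 1"
  have Q: "Q = Suc r" "r > 0" using assms(2) by (auto simp: r_def)
  have "int r dvd int (Q ^ d - 1)"
    using power_diff_1_eq[of "int Q" d] Q by (simp add: of_nat_diff)
  then have "r dvd Q ^ d - 1"
    by (simp only: int_dvd_int_iff)
  then obtain s where "Q ^ d - 1 = r * s" ..
  then have card: "card (UNIV :: 'f set) = r * s + 1"
    using assms by (metis Suc_eq_plus1 Suc_pred' nat_zero_less_power_iff not_one_less_zero zero_less_iff_neq_zero)
  have eq: "(subF Q :: 'f set) = insert 0 {x. x ^ r = 1}"
    by (auto simp: subF_def Q)
  show ?thesis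
    unfolding eq using card_roots_of_unity[OF card Q(2)] Q by (simp add: zero_power)
qed

lemma subF_power_mono: "x \<in> subF Q \<Longrightarrow> x \<in> subF (Q ^ e)"
  by (induction e) (auto simp: subF_def power_mult)

section \<open>Subfield spans and sets of admissible scalars\<close>

definition coeffs_in :: "'f::field vec3 set \<Rightarrow> 'f vec3 \<Rightarrow> 'f set" where
  "coeffs_in M v = {x. x \<cdot> v \<in> M}"

definition indep2 :: "'f::field vec3 \<Rightarrow> 'f vec3 \<Rightarrow> bool" where
  "indep2 u v \<longleftrightarrow> (\<forall>x y. x \<cdot> u + y \<cdot> v = 0 \<longrightarrow> x = 0 \<and> y = 0)"

definition indep3 :: "'f::field vec3 \<Rightarrow> 'f vec3 \<Rightarrow> 'f vec3 \<Rightarrow> bool" where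
  "indep3 u v z \<longleftrightarrow> (\<forall>x y w. x \<cdot> u + y \<cdot> v + w \<cdot> z = 0 \<longrightarrow> x = 0 \<and> y = 0 \<and> w = 0)"

definition span2 :: "'f::field set \<Rightarrow> 'f vec3 \<Rightarrow> 'f vec3 \<Rightarrow> 'f vec3 set" where
  "span2 K u v = (\<lambda>(s, t). s \<cdot> u + t \<cdot> v) ` (K \<times> K)"

definition span3 :: "'f::field set \<Rightarrow> 'f vec3 \<Rightarrow> 'f vec3 \<Rightarrow> 'f vec3 \<Rightarrow> 'f vec3 set" where
  "span3 K u v z = (\<lambda>(s, t, w). s \<cdot> u + t \<cdot> v + w \<cdot> z) ` (K \<times> K \<times> K)"

lemma span2I: "s \<in> K \<Longrightarrow> t \<in> K \<Longrightarrow> s \<cdot> u + t \<cdot> v \<in> span2 K u v"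
  unfolding span2_def by (rule image_eqI[of _ _ "(s, t)"]) auto

lemma span3I:
  "s \<in> K \<Longrightarrow> t \<in> K \<Longrightarrow> w \<in> K \<Longrightarrow> s \<cdot> u + t \<cdot> v + w \<cdot> z \<in> span3 K u v z"
  unfolding span3_def by (rule image_eqI[of _ _ "(s, t, w)"]) auto

lemma span3E:
  assumes "a \<in> span3 K u v z"
  obtains s t w where "s \<in> K" "t \<in> K" "w \<in> K" "a = s \<cdot> u + t \<cdot> v + w \<cdot> z"
  using assms unfolding span3_def by auto

lemma indep2_eq_iff:
  assumes "indep2 u v"
  shows "x \<cdot> u + y \<cdot> v = x' \<cdot> u + y' \<cdot> v \<longleftrightarrow> x = x' \<and> y = y'"
proof
  assume "x \<cdot> u + y \<cdot> v = x' \<cdot> u + y' \<cdot> v"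
  then have "(x - x') \<cdot> u + (y - y') \<cdot> v = 0"
    by (simp add: smult_diff_left algebra_simps)
  then show "x = x' \<and> y = y'"
    using assms by (metis indep2_def eq_iff_diff_eq_0)
qed auto

lemma indep3_eq_iff:
  assumes "indep3 u v z"
  shows "x \<cdot> u + y \<cdot> v + w \<cdot> z = x' \<cdot> u + y' \<cdot> v + w' \<cdot> z \<longleftrightarrow> x = x' \<and> y = y' \<and> w = w'"
proof
  assume "x \<cdot> u + y \<cdot> v + w \<cdot> z = x' \<cdot> u + y' \<cdot> v + w' \<cdot> z"
  then have "(x - x') \<cdot> u + (y - y') \<cdot> v + (w - w') \<cdot> z = 0"
    by (simp add: smult_diff_left algebra_simps)
  then show "x = x' \<and> y = y' \<and> w = w'"
    using assms by (metis indep3_def eq_iff_diff_eq_0)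
qed auto

lemma card_span2: "indep2 u v \<Longrightarrow> card (span2 K u v) = card K ^ 2"
  unfolding span2_def
  by (subst card_image) (auto simp: inj_on_def indep2_eq_iff card_cartesian_product power2_eq_square)

lemma card_span3: "indep3 u v z \<Longrightarrow> card (span3 K u v z) = card K ^ 3"
  unfolding span3_def
  by (subst card_image) (auto simp: inj_on_def indep3_eq_iff card_cartesian_product power3_eq_cube)

lemma indep2I:
  assumes "u \<noteq> 0" "\<And>x. v \<noteq> x \<cdot> u"
  shows "indep2 u v"
  unfolding indep2_def
proof (intro allI impI)
  fix x y assume 0: "x \<cdot> u + y \<cdot> v = 0"
  have "y = 0"
  proof (rule ccontr)
    assume y: "y \<noteq> 0"
    have "y \<cdot> v = (- x) \<cdot> u"
      using 0 by (simp add: smult_minus_left eq_neg_iff_add_eq_0 add.commute)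
    then have "inverse y \<cdot> y \<cdot> v = inverse y \<cdot> (- x) \<cdot> u" by simp
    then show False using y assms(2) by simp
  qed
  then show "x = 0 \<and> y = 0" using 0 assms(1) by simp
qed

lemma indep3I:
  assumes "indep2 u v" "u \<in> Hinf" "v \<in> Hinf" "z \<notin> Hinf"
  shows "indep3 u v z"
  unfolding indep3_def
proof (intro allI impI)
  fix x y w assume 0: "x \<cdot> u + y \<cdot> v + w \<cdot> z = 0"
  then have "snd (snd (x \<cdot> u + y \<cdot> v + w \<cdot> z)) = 0" by simp
  then have "w = 0" using assms(2-4) by (simp add: Hinf_iff)
  then show "x = 0 \<and> y = 0 \<and> w = 0"
    using 0 assms(1) by (simp add: indep2_def)
qed

context finite_subfield
begin

lemma lsub_span2: "lsub K (span2 K u v)"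
  unfolding lsub_def span2_def
proof (intro conjI ballI)
  show "0 \<in> (\<lambda>(s, t). s \<cdot> u + t \<cdot> v) ` (K \<times> K)"
    by (rule image_eqI[of _ _ "(0, 0)"]) (auto simp: zero)
  fix a assume "a \<in> (\<lambda>(s, t). s \<cdot> u + t \<cdot> v) ` (K \<times> K)"
  then obtain s t where a: "s \<in> K" "t \<in> K" "a = s \<cdot> u + t \<cdot> v" by auto
  show "x \<cdot> a \<in> (\<lambda>(s, t). s \<cdot> u + t \<cdot> v) ` (K \<times> K)" if "x \<in> K" for x
    by (rule image_eqI[of _ _ "(x * s, x * t)"]) (use a that in \<open>auto simp: smult_add_right mult\<close>)
  fix b assume "b \<in> (\<lambda>(s, t). s \<cdot> u + t \<cdot> v) ` (K \<times> K)"
  then obtain s' t' where b: "s' \<in> K" "t' \<in> K" "b = s' \<cdot> u + t' \<cdot> v" by auto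
  show "a + b \<in> (\<lambda>(s, t). s \<cdot> u + t \<cdot> v) ` (K \<times> K)"
    by (rule image_eqI[of _ _ "(s + s', t + t')"]) (use a b in \<open>auto simp: smult_add_left add\<close>)
qed

lemma lsub_span3: "lsub K (span3 K u v z)"
  unfolding lsub_def span3_def
proof (intro conjI ballI)
  let ?f = "\<lambda>(s, t, w). s \<cdot> u + t \<cdot> v + w \<cdot> z"
  show "0 \<in> ?f ` (K \<times> K \<times> K)"
    by (rule image_eqI[of _ _ "(0, 0, 0)"]) (auto simp: zero)
  fix a assume "a \<in> ?f ` (K \<times> K \<times> K)"
  then obtain s t w where a: "s \<in> K" "t \<in> K" "w \<in> K" "a = s \<cdot> u + t \<cdot> v + w \<cdot> z" by auto
  show "x \<cdot> a \<in> ?f ` (K \<times> K \<times> K)" if "x \<in> K" for x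
    by (rule image_eqI[of _ _ "(x * s, x * t, x * w)"])
      (use a that in \<open>auto simp: smult_add_right mult\<close>)
  fix b assume "b \<in> ?f ` (K \<times> K \<times> K)"
  then obtain s' t' w' where b: "s' \<in> K" "t' \<in> K" "w' \<in> K" "b = s' \<cdot> u + t' \<cdot> v + w' \<cdot> z" by auto
  show "a + b \<in> ?f ` (K \<times> K \<times> K)"
    by (rule image_eqI[of _ _ "(s + s', t + t', w + w')"])
      (use a b in \<open>auto simp: smult_add_left add\<close>)
qed

lemma coeffs_in_span3:
  assumes "indep3 u v z" "a \<in> span3 K u v z" "a \<noteq> 0"
  shows "coeffs_in (span3 K u v z) a = K"
proof (intro equalityI subsetI)
  fix x assume "x \<in> K"
  then show "x \<in> coeffs_in (span3 K u v z) a"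
    using assms(2) lsub_smult[OF lsub_span3] by (simp add: coeffs_in_def)
next
  fix x assume "x \<in> coeffs_in (span3 K u v z) a"
  then obtain s t w where x: "s \<in> K" "t \<in> K" "w \<in> K" "x \<cdot> a = s \<cdot> u + t \<cdot> v + w \<cdot> z"
    by (auto simp: coeffs_in_def span3_def)
  obtain s' t' w' where a: "s' \<in> K" "t' \<in> K" "w' \<in> K" "a = s' \<cdot> u + t' \<cdot> v + w' \<cdot> z"
    using assms(2) by (auto simp: span3_def)
  have "s' \<noteq> 0 \<or> t' \<noteq> 0 \<or> w' \<noteq> 0" using a assms(3) by auto
  moreover have "x * s' \<in> K" "x * t' \<in> K" "x * w' \<in> K"
    using x a by (auto simp: smult_add_right indep3_eq_iff[OF assms(1)])
  ultimately show "x \<in> K" using a mult_cancel by blast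
qed

lemma coeffs_in_span2:
  assumes "indep2 u v" "a \<in> span2 K u v" "a \<noteq> 0"
  shows "coeffs_in (span2 K u v) a = K"
proof (intro equalityI subsetI)
  fix x assume "x \<in> K"
  then show "x \<in> coeffs_in (span2 K u v) a"
    using assms(2) lsub_smult[OF lsub_span2] by (simp add: coeffs_in_def)
next
  fix x assume "x \<in> coeffs_in (span2 K u v) a"
  then obtain s t where x: "s \<in> K" "t \<in> K" "x \<cdot> a = s \<cdot> u + t \<cdot> v"
    by (auto simp: coeffs_in_def span2_def)
  obtain s' t' where a: "s' \<in> K" "t' \<in> K" "a = s' \<cdot> u + t' \<cdot> v"
    using assms(2) by (auto simp: span2_def)
  have "s' \<noteq> 0 \<or> t' \<noteq> 0" using a assms(3) by auto
  moreover have "x * s' \<in> K" "x * t' \<in> K"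
    using x a by (auto simp: smult_add_right indep2_eq_iff[OF assms(1)])
  ultimately show "x \<in> K" using a mult_cancel by blast
qed

end

text \<open>Let \<open>A\<close> be the common coefficient set of two independent vectors \<open>u\<close>, \<open>v\<close> of \<open>M\<close> and of \<open>u + v\<close>.
  For \<open>a \<in> A\<close> the coefficient set of \<open>a u + v\<close> is \<open>{x \<in> A. x a \<in> A}\<close>, so comparing sizes shows that
  \<open>A\<close> is closed under multiplication, which makes it the subfield of order \<open>Q\<close>.\<close>

lemma scattered_eq_span2:
  fixes M :: "'f::{field,finite} vec3 set"
  assumes zero: "0 \<in> M" and add: "\<And>u v. u \<in> M \<Longrightarrow> v \<in> M \<Longrightarrow> u + v \<in> M"
    and cM: "card M = Q ^ 2" and Q: "Q > 1" and cK: "card (subF Q :: 'f set) = Q"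
    and coeffs: "\<And>v. v \<in> M \<Longrightarrow> v \<noteq> 0 \<Longrightarrow> card (coeffs_in M v) = Q"
  shows "\<exists>u\<in>M. \<exists>v\<in>M. indep2 u v \<and> M = span2 (subF Q) u v"
proof -
  have "card M \<noteq> card {0 :: 'f vec3}" using cM Q by (simp add: power2_eq_square)
  then have "M \<noteq> {0}" by blast
  then obtain u where u: "u \<in> M" "u \<noteq> 0" using zero by blast
  have "card ((\<lambda>x. x \<cdot> u) ` coeffs_in M u) = Q"
    using coeffs[OF u] u by (simp add: card_image inj_smult_left)
  then have "\<not> M \<subseteq> (\<lambda>x. x \<cdot> u) ` coeffs_in M u"
    using card_mono[of "(\<lambda>x. x \<cdot> u) ` coeffs_in M u" M] cM Q by (auto simp: power2_eq_square)
  then obtain v where v: "v \<in> M" "\<And>x. v \<noteq> x \<cdot> u"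
    unfolding coeffs_in_def by blast
  have ind: "indep2 u v" using u(2) v(2) by (rule indep2I)
  have "v \<noteq> 0" using v(2)[of 0] by auto
  define A where "A = coeffs_in M u"
  define A' where "A' = coeffs_in M v"
  have M: "M = (\<lambda>(s, t). s \<cdot> u + t \<cdot> v) ` (A \<times> A')"
  proof (rule sym, rule card_subset_eq)
    show "(\<lambda>(s, t). s \<cdot> u + t \<cdot> v) ` (A \<times> A') \<subseteq> M"
      by (auto simp: A_def A'_def coeffs_in_def intro!: add)
    have "card ((\<lambda>(s, t). s \<cdot> u + t \<cdot> v) ` (A \<times> A')) = card (A \<times> A')"
      by (rule card_image) (auto simp: inj_on_def indep2_eq_iff[OF ind])
    then show "card ((\<lambda>(s, t). s \<cdot> u + t \<cdot> v) ` (A \<times> A')) = card M"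
      using coeffs u v(1) \<open>v \<noteq> 0\<close>
      by (simp add: card_cartesian_product cM A_def A'_def power2_eq_square)
  qed simp
  have in_M: "s \<cdot> u + t \<cdot> v \<in> M \<longleftrightarrow> s \<in> A \<and> t \<in> A'" for s t
    unfolding M by (auto simp: indep2_eq_iff[OF ind])
  have cA: "card A = Q" and cA': "card A' = Q"
    using coeffs u v(1) \<open>v \<noteq> 0\<close> by (auto simp: A_def A'_def)
  have nz: "s \<cdot> u + v \<noteq> 0" for s
    using ind by (metis indep2_def smult_1 zero_neq_one)
  have one: "1 \<in> A" "1 \<in> A'" using u(1) v(1) by (auto simp: A_def A'_def coeffs_in_def)
  have "coeffs_in M (u + v) = A \<inter> A'"
    by (auto simp: coeffs_in_def smult_add_right in_M)
  then have "card (A \<inter> A') = Q"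
    using coeffs[of "u + v"] add[OF u(1) v(1)] nz[of 1] by simp
  then have "A \<inter> A' = A" "A \<inter> A' = A'"
    using cA cA' card_subset_eq[of A "A \<inter> A'"] card_subset_eq[of A' "A \<inter> A'"] by auto
  then have AA': "A' = A" by simp
  have mult: "x * y \<in> A" if "x \<in> A" "y \<in> A" for x y
  proof -
    have "x \<cdot> u + v \<in> M" using in_M[of x 1] that one by simp
    then have "card (coeffs_in M (x \<cdot> u + v)) = Q" using coeffs nz by blast
    moreover have "coeffs_in M (x \<cdot> u + v) = {w \<in> A. w * x \<in> A}"
      by (auto simp: coeffs_in_def smult_add_right in_M AA')
    ultimately have "{w \<in> A. w * x \<in> A} = A"
      using cA card_subset_eq[of A "{w \<in> A. w * x \<in> A}"] by auto
    then have "y \<in> {w \<in> A. w * x \<in> A}" using that(2) by metis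
    then show ?thesis by (simp add: mult.commute[of x])
  qed
  have "0 \<in> A" using zero by (simp add: A_def coeffs_in_def)
  then have "A \<subseteq> subF Q"
    using power_card_of_mult_closed[of A] mult cA by (auto simp: subF_def)
  then have "A = subF Q" using cA cK by (intro card_subset_eq) auto
  then show ?thesis
    using u(1) v(1) ind M AA' unfolding span2_def by blast
qed

lemma card_quotient_by_scalars:
  fixes S :: "'f::{field,finite} vec3 set"
  assumes "0 \<in> S" and coeffs: "\<And>v. v \<in> S \<Longrightarrow> v \<noteq> 0 \<Longrightarrow> card (coeffs_in S v) = r"
    and f: "\<And>u v. v \<noteq> 0 \<Longrightarrow> u \<noteq> 0 \<Longrightarrow> f u = f v \<longleftrightarrow> (\<exists>x. u = x \<cdot> v)"
  shows "card S = (r - 1) * card (f ` (S - {0})) + 1"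
proof -
  have "card (S - {0}) = (\<Sum>y\<in>f ` (S - {0}). card {u \<in> S - {0}. f u = y})"
    using sum.image_gen[of "S - {0}" "\<lambda>_. 1 :: nat" f] by simp
  also have "\<dots> = (\<Sum>y\<in>f ` (S - {0}). r - 1)"
  proof (rule sum.cong)
    fix y assume "y \<in> f ` (S - {0})"
    then obtain v where v: "v \<in> S" "v \<noteq> 0" "y = f v" by auto
    have "{u \<in> S - {0}. f u = y} = (\<lambda>x. x \<cdot> v) ` (coeffs_in S v - {0})"
    proof (intro equalityI subsetI)
      fix u assume "u \<in> {u \<in> S - {0}. f u = y}"
      then have u: "u \<in> S" "u \<noteq> 0" "f u = f v" using v by auto
      then obtain x where "u = x \<cdot> v" using f[OF v(2) u(2)] by blast
      then show "u \<in> (\<lambda>x. x \<cdot> v) ` (coeffs_in S v - {0})"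
        using u by (intro image_eqI[of _ _ x]) (simp_all add: coeffs_in_def)
    next
      fix u assume "u \<in> (\<lambda>x. x \<cdot> v) ` (coeffs_in S v - {0})"
      then obtain x where x: "u = x \<cdot> v" "u \<in> S" "x \<noteq> 0" by (auto simp: coeffs_in_def)
      then have "u \<noteq> 0" using v by simp
      then show "u \<in> {u \<in> S - {0}. f u = y}"
        using f[OF v(2), of u] x v by blast
    qed
    then have "card {u \<in> S - {0}. f u = y} = card (coeffs_in S v - {0})"
      using v by (simp add: card_image inj_smult_left)
    also have "\<dots> = r - 1"
      using coeffs[OF v(1,2)] \<open>0 \<in> S\<close> by (simp add: coeffs_in_def card_Diff_singleton)
    finally show "card {u \<in> S - {0}. f u = y} = r - 1" .
  qed simp
  also have "\<dots> = (r - 1) * card (f ` (S - {0}))" by simp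
  finally show ?thesis
    using \<open>0 \<in> S\<close> by (metis Suc_eq_plus1 card_Suc_Diff1 finite)
qed

section \<open>Points, spread elements and subplanes\<close>

lemma (in finite_subfield) in_proj_pt_self: "v \<in> proj_pt K v"
  using one by (force simp: proj_pt_def)

lemma (in finite_subfield) proj_pt_smult:
  assumes "s \<in> K" "s \<noteq> 0"
  shows "proj_pt K (s \<cdot> v) = proj_pt K v"
proof (intro equalityI subsetI)
  fix w assume "w \<in> proj_pt K (s \<cdot> v)"
  then obtain t where "t \<in> K" "t \<noteq> 0" "w = (t * s) \<cdot> v" by (auto simp: proj_pt_def)
  then show "w \<in> proj_pt K v"
    unfolding proj_pt_def using assms by (intro CollectI exI[of _ "t * s"]) (auto intro: mult)
next
  fix w assume "w \<in> proj_pt K v"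
  then obtain t where "t \<in> K" "t \<noteq> 0" "w = t \<cdot> v" by (auto simp: proj_pt_def)
  then show "w \<in> proj_pt K (s \<cdot> v)"
    unfolding proj_pt_def using assms by (intro CollectI exI[of _ "t / s"]) (auto intro: divide)
qed

lemma (in finite_subfield) proj_pt_eq_iff:
  "proj_pt K u = proj_pt K v \<longleftrightarrow> (\<exists>t\<in>K. t \<noteq> 0 \<and> u = t \<cdot> v)"
proof
  assume "proj_pt K u = proj_pt K v"
  then have "u \<in> proj_pt K v" using in_proj_pt_self[of u] by simp
  then show "\<exists>t\<in>K. t \<noteq> 0 \<and> u = t \<cdot> v" unfolding proj_pt_def by blast
qed (auto simp: proj_pt_smult)

lemma (in finite_subfield) proj_pt_in_pts_iff:
  assumes "lsub K W"
  shows "proj_pt K v \<in> pts K W \<longleftrightarrow> v \<in> W \<and> v \<noteq> 0"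
proof
  assume "proj_pt K v \<in> pts K W"
  then obtain w where w: "w \<in> W" "w \<noteq> 0" "proj_pt K v = proj_pt K w" by (auto simp: pts_def)
  then obtain t where "t \<in> K" "t \<noteq> 0" "v = t \<cdot> w" using proj_pt_eq_iff by blast
  then show "v \<in> W \<and> v \<noteq> 0" using w lsub_smult[OF assms] by simp
next
  assume "v \<in> W \<and> v \<noteq> 0"
  then show "proj_pt K v \<in> pts K W" unfolding pts_def by blast
qed

lemma pts_eq_image: "pts K W = proj_pt K ` (W - {0})"
  unfolding pts_def by blast

interpretation UNIV: finite_subfield "UNIV :: 'f::{field,finite} set"
  by standard auto

lemma proj_pt_UNIV_eq_iff:
  fixes u v :: "'f::{field,finite} vec3"
  assumes "u \<noteq> 0"
  shows "proj_pt UNIV u = proj_pt UNIV v \<longleftrightarrow> (\<exists>x. u = x \<cdot> v)"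
proof -
  have "x \<noteq> 0" if "u = x \<cdot> v" for x
    using that assms by auto
  then show ?thesis unfolding UNIV.proj_pt_eq_iff by blast
qed

definition spread_elt :: "nat \<Rightarrow> 'f::field set \<Rightarrow> 'f vec3 \<Rightarrow> 'f vec3 set set" where
  "spread_elt q A v = (\<lambda>x. proj_pt (subF q) (x \<cdot> v)) ` (A - {0})"

lemma Dk_altdef: "Dk q j = spread_elt q (subF (q ^ j)) ` (Hinf - {0})"
proof -
  have 1: "{proj_pt (subF q) (a * x, b * x, 0) |x. x \<in> subF (q ^ j) \<and> x \<noteq> 0}
      = spread_elt q (subF (q ^ j)) (a, b, 0)" for a b :: 'a
    unfolding spread_elt_def by (auto simp: mult.commute)
  have 2: "Hinf - {0} = {(a, b, 0) | a b. (a, b) \<noteq> (0, 0 :: 'a)}"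
    by (auto simp: Hinf_def zero_prod_def)
  show ?thesis unfolding Dk_def 1 2 by blast
qed

lemma sig_aff_pts_altdef:
  "sig_aff_pts q = {proj_pt (subF q) v | v. v \<in> Vsig q \<and> v \<notin> Hinf}"
  unfolding sig_aff_pts_def Vsig_def Hinf_def by blast

lemma proj_pt_in_linf_iff:
  fixes v :: "'f::{field,finite} vec3"
  assumes "v \<noteq> 0"
  shows "proj_pt UNIV v \<in> linf \<longleftrightarrow> v \<in> Hinf"
proof
  assume "proj_pt UNIV v \<in> linf"
  then obtain a b where "proj_pt UNIV v = proj_pt UNIV (a, b, 0)" by (auto simp: linf_def)
  then show "v \<in> Hinf" by (auto simp: proj_pt_UNIV_eq_iff[OF assms] Hinf_iff)
next
  assume "v \<in> Hinf"
  then obtain a b where "v = (a, b, 0)" by (auto simp: Hinf_def)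
  then show "proj_pt UNIV v \<in> linf"
    using assms unfolding linf_def zero_prod_def by blast
qed

lemma proj_pt_in_plane_aff_pts_iff:
  fixes v :: "'f::{field,finite} vec3"
  shows "proj_pt UNIV v \<in> plane_aff_pts \<longleftrightarrow> v \<notin> Hinf"
proof
  assume "proj_pt UNIV v \<in> plane_aff_pts"
  then obtain a b c where "c \<noteq> 0" "proj_pt UNIV v = proj_pt UNIV (a, b, c)"
    by (auto simp: plane_aff_pts_def)
  then show "v \<notin> Hinf" by (auto simp: UNIV.proj_pt_eq_iff Hinf_iff)
next
  assume "v \<notin> Hinf"
  then obtain a b c where "v = (a, b, c)" "c \<noteq> 0" by (cases v) (auto simp: Hinf_def)
  then show "proj_pt UNIV v \<in> plane_aff_pts"
    unfolding plane_aff_pts_def by blast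
qed

lemma phi_proj_pt:
  fixes v :: "'f::{field,finite} vec3"
  assumes "v \<notin> Hinf"
  shows "phi q (proj_pt UNIV v) = proj_pt (subF q) ((1 / snd (snd v)) \<cdot> v)"
proof -
  have nz: "snd (snd v) \<noteq> 0" using assms by (simp add: Hinf_iff)
  have "(SOME w. w \<in> proj_pt UNIV v \<and> snd (snd w) = 1) = (1 / snd (snd v)) \<cdot> v"
  proof (rule some_equality)
    show "(1 / snd (snd v)) \<cdot> v \<in> proj_pt UNIV v \<and> snd (snd ((1 / snd (snd v)) \<cdot> v)) = 1"
      unfolding proj_pt_def using nz by force
  next
    fix w assume w: "w \<in> proj_pt UNIV v \<and> snd (snd w) = 1"
    then obtain t where "w = t \<cdot> v" by (auto simp: proj_pt_def)
    moreover from this have "t = 1 / snd (snd v)" using w nz by (simp add: eq_divide_eq)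
    ultimately show "w = (1 / snd (snd v)) \<cdot> v" by simp
  qed
  then show ?thesis by (simp add: phi_def)
qed

lemma subplane_altdef:
  "subplane q k B \<longleftrightarrow>
    (\<exists>u v z. indep3 u v z \<and> B = proj_pt UNIV ` (span3 (subF (q ^ k)) u v z - {0}))"
proof -
  have "{proj_pt UNIV (s \<cdot> u + t \<cdot> v + w \<cdot> z) | s t w.
            s \<in> subF (q ^ k) \<and> t \<in> subF (q ^ k) \<and> w \<in> subF (q ^ k) \<and> (s, t, w) \<noteq> (0, 0, 0)}
      = proj_pt UNIV ` (span3 (subF (q ^ k)) u v z - {0})" (is "?A = ?B")
    if "indep3 u v z" for u v z :: "'a vec3"
  proof -
    have nz: "s \<cdot> u + t \<cdot> v + w \<cdot> z \<noteq> 0 \<longleftrightarrow> (s, t, w) \<noteq> (0, 0, 0)" for s t w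
      using indep3_eq_iff[OF that, of s t w 0 0 0] by simp
    show ?thesis
    proof (intro equalityI subsetI)
      fix P assume "P \<in> ?A"
      then obtain s t w where "P = proj_pt UNIV (s \<cdot> u + t \<cdot> v + w \<cdot> z)"
        "s \<in> subF (q ^ k)" "t \<in> subF (q ^ k)" "w \<in> subF (q ^ k)" "(s, t, w) \<noteq> (0, 0, 0)" by blast
      moreover from this have "s \<cdot> u + t \<cdot> v + w \<cdot> z \<in> span3 (subF (q ^ k)) u v z - {0}"
        by (intro DiffI span3I) (simp_all only: nz singleton_iff not_False_eq_True)
      ultimately show "P \<in> ?B" by (metis imageI)
    next
      fix P assume "P \<in> ?B"
      then obtain a where a: "a \<in> span3 (subF (q ^ k)) u v z" "a \<noteq> 0" "P = proj_pt UNIV a" by blast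
      from a(1) obtain s t w where "s \<in> subF (q ^ k)" "t \<in> subF (q ^ k)" "w \<in> subF (q ^ k)"
        and "a = s \<cdot> u + t \<cdot> v + w \<cdot> z" by (rule span3E)
      then show "P \<in> ?A" using a(2,3) nz[of s t w] by blast
    qed
  qed
  then show ?thesis
    unfolding subplane_def indep3_def[symmetric] by (intro ex_cong1 conj_cong refl) (simp only:)
qed

lemma quadratic_count:
  fixes Q N :: nat
  assumes "Q > 1"
  shows "Q ^ 2 = (Q - 1) * N + 1 \<longleftrightarrow> N = Q + 1"
proof -
  obtain r where r: "Q = Suc r" "r > 0" using assms by (cases Q) auto
  have "Q ^ 2 = (Q - 1) * (Q + 1) + 1"
    unfolding r by (simp add: power2_eq_square)
  then have "Q ^ 2 = (Q - 1) * N + 1 \<longleftrightarrow> (Q - 1) * (Q + 1) = (Q - 1) * N" by simp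
  also have "\<dots> \<longleftrightarrow> N = Q + 1" unfolding mult_cancel1 using r by auto
  finally show ?thesis .
qed

definition affine_hull :: "nat \<Rightarrow> 'f::field vec3 set \<Rightarrow> 'f vec3 \<Rightarrow> 'f vec3 set" where
  "affine_hull q M z = (\<lambda>(a, l). a + l \<cdot> z) ` (M \<times> subF q)"

lemma affine_hullI: "a \<in> M \<Longrightarrow> l \<in> subF q \<Longrightarrow> a + l \<cdot> z \<in> affine_hull q M z"
  unfolding affine_hull_def by (rule image_eqI[of _ _ "(a, l)"]) auto

lemma affine_hullE:
  assumes "w \<in> affine_hull q M z"
  obtains a l where "a \<in> M" "l \<in> subF q" "w = a + l \<cdot> z"
  using assms unfolding affine_hull_def by auto

section \<open>Normal forms of the two sides\<close>

locale subfield_tower =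
  fixes p m q n k :: nat and ty :: "'f::{field,finite} itself"
  assumes prime: "prime p" and m: "m > 0" and q: "q = p ^ m" and n: "n \<ge> 1"
    and card_UNIV: "card (UNIV :: 'f set) = q ^ n" and dvd: "k dvd n"
begin

abbreviation L :: "'f set" where "L \<equiv> subF q"
abbreviation K :: "'f set" where "K \<equiv> subF (q ^ k)"

lemma k_pos: "k > 0"
  using dvd n by (cases k) auto

lemma q_gt_1: "q > 1"
  unfolding q using prime m by (metis one_less_power prime_gt_1_nat)

lemma qk_gt_1: "q ^ k > 1"
  using q_gt_1 k_pos by (rule one_less_power)

lemma char: "CHAR('f) = p"
  using prime_char_of_card[where 'f = 'f, OF prime, of "m * n"] card_UNIV by (simp add: q power_mult)

sublocale L: finite_subfield L
  using prime char q by (rule finite_subfield_subF)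

sublocale K: finite_subfield K
  by (rule finite_subfield_subF[OF prime char, of _ "m * k"]) (simp add: q power_mult)

lemma card_L: "card L = q"
  using card_UNIV q_gt_1 by (rule card_subF)

lemma card_K: "card K = q ^ k"
proof -
  have "card (UNIV :: 'f set) = (q ^ k) ^ (n div k)"
    using dvd by (simp add: card_UNIV power_mult[symmetric])
  then show ?thesis using qk_gt_1 by (rule card_subF)
qed

lemma subF_top: "subF (q ^ n) = (UNIV :: 'f set)"
  using power_card_of_mult_closed[of "UNIV :: 'f set"] card_UNIV by (auto simp: subF_def)

lemma L_subset_K: "L \<subseteq> K"
  using subF_power_mono by blast

lemma proj_pt_in_spread_elt_iff:
  fixes v w :: "'f vec3"
  shows "proj_pt L w \<in> spread_elt q UNIV v \<longleftrightarrow> (\<exists>x. x \<noteq> 0 \<and> w = x \<cdot> v)"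
proof
  assume "proj_pt L w \<in> spread_elt q UNIV v"
  then obtain x where x: "x \<noteq> 0" "proj_pt L w = proj_pt L (x \<cdot> v)" by (auto simp: spread_elt_def)
  then obtain t where "t \<noteq> 0" "w = (t * x) \<cdot> v" using L.proj_pt_eq_iff by auto
  then show "\<exists>x. x \<noteq> 0 \<and> w = x \<cdot> v" using x by (intro exI[of _ "t * x"]) simp
next
  assume "\<exists>x. x \<noteq> 0 \<and> w = x \<cdot> v"
  then show "proj_pt L w \<in> spread_elt q UNIV v" by (auto simp: spread_elt_def)
qed

lemma spread_elt_smult:
  fixes v :: "'f vec3"
  assumes "x \<noteq> 0"
  shows "spread_elt q UNIV (x \<cdot> v) = spread_elt q UNIV v"
proof -
  have "(\<lambda>y. y * x) ` (UNIV - {0}) = UNIV - {0}"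
    using assms by (auto intro!: image_eqI[of _ _ "_ / x"])
  then have "spread_elt q UNIV v = (\<lambda>y. proj_pt L (y \<cdot> v)) ` (\<lambda>y. y * x) ` (UNIV - {0})"
    by (simp add: spread_elt_def)
  then show ?thesis by (simp add: spread_elt_def image_image)
qed

lemma spread_elt_eq_iff:
  fixes u v :: "'f vec3"
  assumes "u \<noteq> 0"
  shows "spread_elt q UNIV u = spread_elt q UNIV v \<longleftrightarrow> (\<exists>x. u = x \<cdot> v)"
proof
  assume "spread_elt q UNIV u = spread_elt q UNIV v"
  moreover have "proj_pt L u \<in> spread_elt q UNIV u"
    unfolding proj_pt_in_spread_elt_iff by (rule exI[of _ 1]) simp
  ultimately show "\<exists>x. u = x \<cdot> v"
    unfolding proj_pt_in_spread_elt_iff[symmetric] by (metis proj_pt_in_spread_elt_iff)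
next
  assume "\<exists>x. u = x \<cdot> v"
  then obtain x where "u = x \<cdot> v" "x \<noteq> 0" using assms by auto
  then show "spread_elt q UNIV u = spread_elt q UNIV v" by (simp add: spread_elt_smult)
qed

lemma spread_elt_Int_pts:
  assumes "lsub L M" "v \<noteq> 0"
  shows "spread_elt q UNIV v \<inter> pts L M = spread_elt q (coeffs_in M v) v"
  using assms(2) by (auto simp: spread_elt_def L.proj_pt_in_pts_iff[OF assms(1)] coeffs_in_def)

lemma spread_elts_meeting:
  assumes M: "lsub L M" "M \<subseteq> Hinf"
  shows "{d \<in> Dk q n. d \<inter> pts L M \<noteq> {}} = spread_elt q UNIV ` (M - {0})"
proof (intro equalityI subsetI)
  fix d assume "d \<in> {d \<in> Dk q n. d \<inter> pts L M \<noteq> {}}"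
  then obtain v where v: "v \<in> Hinf" "v \<noteq> 0" "d = spread_elt q UNIV v"
    and ne: "spread_elt q UNIV v \<inter> pts L M \<noteq> {}"
    by (auto simp: Dk_altdef subF_top)
  then obtain x where "x \<noteq> 0" "x \<cdot> v \<in> M"
    unfolding spread_elt_Int_pts[OF M(1) v(2)] by (auto simp: spread_elt_def coeffs_in_def)
  then show "d \<in> spread_elt q UNIV ` (M - {0})"
    using v by (intro image_eqI[of _ _ "x \<cdot> v"]) (auto simp: spread_elt_smult)
next
  fix d assume "d \<in> spread_elt q UNIV ` (M - {0})"
  then obtain v where v: "v \<in> M" "v \<noteq> 0" "d = spread_elt q UNIV v" by auto
  then have "1 \<in> coeffs_in M v" by (simp add: coeffs_in_def)
  then have "d \<inter> pts L M \<noteq> {}"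
    unfolding v(3) spread_elt_Int_pts[OF M(1) v(2)] by (auto simp: spread_elt_def)
  moreover have "d \<in> Dk q n" using v M(2) by (auto simp: Dk_altdef subF_top)
  ultimately show "d \<in> {d \<in> Dk q n. d \<inter> pts L M \<noteq> {}}" by simp
qed

lemma spread_elt_Int_pts_dim_iff:
  assumes M: "lsub L M" "M \<subseteq> Hinf" and v: "v \<noteq> 0"
  shows "(\<exists>U\<subseteq>Vsig q. subspace_dim L U k \<and> pts L U = spread_elt q UNIV v \<inter> pts L M)
    \<longleftrightarrow> card (coeffs_in M v) = q ^ k" (is "?lhs \<longleftrightarrow> ?rhs")
proof
  assume ?lhs
  then obtain U where U: "subspace_dim L U k" "pts L U = spread_elt q UNIV v \<inter> pts L M" by blast
  then have sub: "lsub L U" and card: "card U = q ^ k"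
    by (auto simp: L.subspace_dim_iff card_L)
  have *: "w \<in> U \<and> w \<noteq> 0 \<longleftrightarrow> (\<exists>x. x \<noteq> 0 \<and> w = x \<cdot> v) \<and> w \<in> M \<and> w \<noteq> 0" for w
    unfolding L.proj_pt_in_pts_iff[OF sub, symmetric] U(2)
    by (simp add: proj_pt_in_spread_elt_iff L.proj_pt_in_pts_iff[OF M(1)])
  have "U = (\<lambda>x. x \<cdot> v) ` coeffs_in M v"
  proof (intro equalityI subsetI)
    fix w assume "w \<in> U"
    then obtain x where "w = x \<cdot> v" "w \<in> M"
      using *[of w] lsub_0[OF M(1)] smult_0_left[of v] by metis
    then show "w \<in> (\<lambda>x. x \<cdot> v) ` coeffs_in M v" by (simp add: coeffs_in_def)
  next
    fix w assume "w \<in> (\<lambda>x. x \<cdot> v) ` coeffs_in M v"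
    then show "w \<in> U"
      using *[of w] lsub_0[OF sub] by (cases "w = 0") (auto simp: coeffs_in_def)
  qed
  then show ?rhs using card v by (simp add: card_image inj_smult_left)
next
  assume card: ?rhs
  define U where "U = (\<lambda>x. x \<cdot> v) ` coeffs_in M v"
  have "lsub L U"
    unfolding lsub_def
  proof (intro conjI ballI)
    show "0 \<in> U" unfolding U_def
      by (rule image_eqI[of _ _ 0]) (simp_all add: coeffs_in_def lsub_0[OF M(1)])
    fix a assume "a \<in> U"
    then obtain x where x: "a = x \<cdot> v" "x \<cdot> v \<in> M" by (auto simp: U_def coeffs_in_def)
    show "t \<cdot> a \<in> U" if "t \<in> L" for t unfolding U_def
      by (rule image_eqI[of _ _ "t * x"])
        (use x lsub_smult[OF M(1) that x(2)] in \<open>simp_all add: coeffs_in_def\<close>)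
    fix b assume "b \<in> U"
    then obtain y where y: "b = y \<cdot> v" "y \<cdot> v \<in> M" by (auto simp: U_def coeffs_in_def)
    show "a + b \<in> U" unfolding U_def
      by (rule image_eqI[of _ _ "x + y"])
        (use x y lsub_add[OF M(1) x(2) y(2)] in \<open>simp_all add: coeffs_in_def smult_add_left\<close>)
  qed
  moreover have "card U = q ^ k"
    using card v by (simp add: U_def card_image inj_smult_left)
  moreover have "U \<subseteq> Vsig q"
  proof
    fix w assume "w \<in> U"
    then have "w \<in> Hinf" using M(2) by (auto simp: U_def coeffs_in_def)
    then show "w \<in> Vsig q" by (simp add: Hinf_iff Vsig_iff L.zero)
  qed
  moreover have "U - {0} = (\<lambda>x. x \<cdot> v) ` (coeffs_in M v - {0})"
    using v by (auto simp: U_def)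
  then have "pts L U = spread_elt q UNIV v \<inter> pts L M"
    unfolding spread_elt_Int_pts[OF M(1) v] by (simp add: pts_eq_image spread_elt_def image_image)
  ultimately show ?lhs
    by (auto simp: L.subspace_dim_iff card_L)
qed

definition meets_spread_uniformly :: "'f vec3 set \<Rightarrow> bool" where
  "meets_spread_uniformly M \<longleftrightarrow> subspace_dim L M (2 * k)
     \<and> card {d \<in> Dk q n. d \<inter> pts L M \<noteq> {}} = q ^ k + 1
     \<and> (\<forall>d \<in> Dk q n. d \<inter> pts L M \<noteq> {} \<longrightarrow>
          (\<exists>U. U \<subseteq> Vsig q \<and> subspace_dim L U k \<and> pts L U = d \<inter> pts L M))"

lemma meets_spread_uniformly_iff:
  assumes M: "lsub L M" "M \<subseteq> Hinf"
  shows "meets_spread_uniformly M \<longleftrightarrow> (\<exists>u\<in>Hinf. \<exists>v\<in>Hinf. indep2 u v \<and> M = span2 K u v)" (is "?lhs \<longleftrightarrow> ?rhs")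
proof -
  have all: "(\<forall>d \<in> Dk q n. d \<inter> pts L M \<noteq> {} \<longrightarrow>
               (\<exists>U\<subseteq>Vsig q. subspace_dim L U k \<and> pts L U = d \<inter> pts L M))
     \<longleftrightarrow> (\<forall>v\<in>M - {0}. card (coeffs_in M v) = q ^ k)"
  proof -
    have "(\<forall>d \<in> Dk q n. d \<inter> pts L M \<noteq> {} \<longrightarrow>
               (\<exists>U\<subseteq>Vsig q. subspace_dim L U k \<and> pts L U = d \<inter> pts L M))
     \<longleftrightarrow> (\<forall>d \<in> spread_elt q UNIV ` (M - {0}).
               (\<exists>U\<subseteq>Vsig q. subspace_dim L U k \<and> pts L U = d \<inter> pts L M))"
      unfolding spread_elts_meeting[OF M, symmetric] by blast
    then show ?thesis
      using spread_elt_Int_pts_dim_iff[OF M] by simp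
  qed
  have dim: "subspace_dim L M (2 * k) \<longleftrightarrow> card M = (q ^ k) ^ 2"
    using M(1) by (simp add: L.subspace_dim_iff card_L power_mult[symmetric] mult.commute)
  show ?thesis
    unfolding meets_spread_uniformly_def all dim spread_elts_meeting[OF M]
  proof
    assume "card M = (q ^ k) ^ 2 \<and> card (spread_elt q UNIV ` (M - {0})) = q ^ k + 1
      \<and> (\<forall>v\<in>M - {0}. card (coeffs_in M v) = q ^ k)"
    then show ?rhs
      using scattered_eq_span2[of M "q ^ k"] lsub_0[OF M(1)] lsub_add[OF M(1)] qk_gt_1 card_K M(2)
      by blast
  next
    assume ?rhs
    then obtain u v where uv: "indep2 u v" "M = span2 K u v" by blast
    have coeffs: "card (coeffs_in M w) = q ^ k" if "w \<in> M" "w \<noteq> 0" for w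
      using that K.coeffs_in_span2[OF uv(1)] by (simp add: uv(2) card_K)
    have card: "card M = (q ^ k) ^ 2"
      using card_span2[OF uv(1)] by (simp add: uv(2) card_K)
    have card': "card M = (q ^ k - 1) * card (spread_elt q UNIV ` (M - {0})) + 1"
      by (rule card_quotient_by_scalars[OF lsub_0[OF M(1)]])
        (auto simp: coeffs spread_elt_eq_iff simp del: split_paired_Ex)
    have "card (spread_elt q UNIV ` (M - {0})) = q ^ k + 1"
      by (rule iffD1[OF quadratic_count[OF qk_gt_1]], rule trans[OF card[symmetric] card'])
    then show "card M = (q ^ k) ^ 2 \<and> card (spread_elt q UNIV ` (M - {0})) = q ^ k + 1
      \<and> (\<forall>v\<in>M - {0}. card (coeffs_in M v) = q ^ k)"
      using card coeffs by simp
  qed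
qed

lemma spread_elt_Int_span2:
  assumes "indep2 u v" "span2 K u v \<subseteq> Hinf"
    "d \<in> Dk q n" "d \<inter> pts L (span2 K u v) \<noteq> {}"
  shows "d \<inter> pts L (span2 K u v) \<in> Dk q k"
proof -
  have sub: "lsub L (span2 K u v)"
    using K.lsub_span2 L_subset_K by (rule lsub_mono)
  have "d \<in> spread_elt q UNIV ` (span2 K u v - {0})"
    using assms(3,4) spread_elts_meeting[OF sub assms(2)] by blast
  then obtain w where w: "w \<in> span2 K u v" "w \<noteq> 0" "d = spread_elt q UNIV w" by blast
  then have "d \<inter> pts L (span2 K u v) = spread_elt q K w"
    using spread_elt_Int_pts[OF sub w(2)] K.coeffs_in_span2[OF assms(1) w(1,2)] by simp
  then show ?thesis using w assms(2) by (auto simp: Dk_altdef)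
qed

context
  fixes M and z :: "'f vec3"
  assumes M: "lsub L M" "M \<subseteq> Hinf" and z: "snd (snd z) = 1"
begin

lemma snd_snd_affine: "a \<in> M \<Longrightarrow> snd (snd (a + l \<cdot> z)) = l"
  using M(2) z by (auto simp: Hinf_iff)

lemma lsub_affine_hull: "lsub L (affine_hull q M z)"
  unfolding lsub_def affine_hull_def
proof (intro conjI ballI)
  let ?f = "\<lambda>(a, l). a + l \<cdot> z"
  show "0 \<in> ?f ` (M \<times> L)"
    by (rule image_eqI[of _ _ "(0, 0)"]) (auto simp: lsub_0[OF M(1)] L.zero)
  fix a assume "a \<in> ?f ` (M \<times> L)"
  then obtain s l where a: "s \<in> M" "l \<in> L" "a = s + l \<cdot> z" by auto
  show "x \<cdot> a \<in> ?f ` (M \<times> L)" if "x \<in> L" for x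
    by (rule image_eqI[of _ _ "(x \<cdot> s, x * l)"])
      (use a that lsub_smult[OF M(1)] in \<open>simp_all add: smult_add_right L.mult\<close>)
  fix b assume "b \<in> ?f ` (M \<times> L)"
  then obtain s' l' where b: "s' \<in> M" "l' \<in> L" "b = s' + l' \<cdot> z" by auto
  show "a + b \<in> ?f ` (M \<times> L)"
    by (rule image_eqI[of _ _ "(s + s', l + l')"])
      (use a b lsub_add[OF M(1)] in \<open>simp_all add: smult_add_left L.add\<close>)
qed

lemma card_affine_hull: "card (affine_hull q M z) = q * card M"
proof -
  have "inj_on (\<lambda>(a, l). a + l \<cdot> z) (M \<times> L)"
  proof (rule inj_onI, clarify)
    fix a l a' l' assume "a \<in> M" "a' \<in> M" and eq: "a + l \<cdot> z = a' + l' \<cdot> z"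
    then have "l = l'" by (metis snd_snd_affine)
    then show "a = a' \<and> l = l'" using eq by simp
  qed
  then show ?thesis
    by (simp add: affine_hull_def card_image card_cartesian_product card_L)
qed

lemma affine_hull_Int_Hinf: "affine_hull q M z \<inter> Hinf = M"
proof (intro equalityI subsetI)
  fix w assume w: "w \<in> affine_hull q M z \<inter> Hinf"
  then obtain a l where a: "a \<in> M" "w = a + l \<cdot> z" by (auto simp: affine_hull_def)
  then have "l = 0" using w by (metis Hinf_iff IntD2 snd_snd_affine)
  then show "w \<in> M" using a by simp
next
  fix w assume "w \<in> M"
  moreover have "w + 0 \<cdot> z \<in> affine_hull q M z"
    using \<open>w \<in> M\<close> L.zero by (rule affine_hullI)
  ultimately show "w \<in> affine_hull q M z \<inter> Hinf"
    using M(2) by auto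
qed

lemma affine_hull_subset_Vsig: "affine_hull q M z \<subseteq> Vsig q"
proof
  fix w assume "w \<in> affine_hull q M z"
  then obtain a l where "a \<in> M" "l \<in> L" "w = a + l \<cdot> z" by (rule affine_hullE)
  then show "w \<in> Vsig q" unfolding Vsig_iff using snd_snd_affine by metis
qed

lemma affine_hull_not_subset_Hinf: "\<not> affine_hull q M z \<subseteq> Hinf"
proof -
  have "0 + 1 \<cdot> z \<in> affine_hull q M z"
    using lsub_0[OF M(1)] L.one by (rule affine_hullI)
  then show ?thesis using z by (auto simp: Hinf_iff)
qed

lemma aff_part_affine_hull:
  "aff_part q (affine_hull q M z) = (\<lambda>a. proj_pt L (a + z)) ` M"
proof (intro equalityI subsetI)
  fix P assume "P \<in> aff_part q (affine_hull q M z)"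
  then obtain w v where w: "w \<in> affine_hull q M z" "P = proj_pt L w"
    and v: "v \<notin> Hinf" "P = proj_pt L v"
    unfolding aff_part_def sig_aff_pts_altdef pts_def by blast
  from w(1) obtain a l where a: "a \<in> M" "l \<in> L" "w = a + l \<cdot> z"
    by (auto simp: affine_hull_def)
  obtain t where "v = t \<cdot> w" using w(2) v(2) L.proj_pt_eq_iff by metis
  then have "l \<noteq> 0" using v(1) snd_snd_affine[OF a(1), of l] a(3) by (auto simp: Hinf_iff)
  then have "P = proj_pt L ((1 / l) \<cdot> w)"
    using w(2) L.proj_pt_smult[of "1 / l" w] L.divide[OF L.one a(2)] by simp
  also have "(1 / l) \<cdot> w = (1 / l) \<cdot> a + z"
    using \<open>l \<noteq> 0\<close> by (simp add: a(3) smult_add_right)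
  finally show "P \<in> (\<lambda>a. proj_pt L (a + z)) ` M"
    using lsub_smult[OF M(1) L.divide[OF L.one a(2)] a(1)] by blast
next
  fix P assume "P \<in> (\<lambda>a. proj_pt L (a + z)) ` M"
  then obtain a where a: "a \<in> M" "P = proj_pt L (a + z)" by blast
  then have 1: "snd (snd (a + z)) = 1" using snd_snd_affine[of a 1] by simp
  have "a + 1 \<cdot> z \<in> affine_hull q M z"
    using a(1) L.one by (rule affine_hullI)
  moreover have "a + z \<noteq> 0" using 1 by (metis snd_zero zero_neq_one)
  moreover have "a + z \<in> Vsig q" "a + z \<notin> Hinf"
    using 1 L.one by (simp_all only: Vsig_iff Hinf_iff) simp_all
  ultimately show "P \<in> aff_part q (affine_hull q M z)"
    unfolding aff_part_def sig_aff_pts_altdef pts_def a(2) smult_1 by blast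
qed

end

lemma eq_affine_hull:
  assumes W: "lsub L W" "W \<subseteq> Vsig q" "\<not> W \<subseteq> Hinf"
  shows "\<exists>z. snd (snd z) = 1 \<and> W = affine_hull q (W \<inter> Hinf) z"
proof -
  obtain w where w: "w \<in> W" "snd (snd w) \<noteq> 0" using W(3) Hinf_iff by blast
  define z where "z = (1 / snd (snd w)) \<cdot> w"
  have "1 / snd (snd w) \<in> L"
    using w W(2) by (intro L.divide L.one) (auto simp: Vsig_iff)
  then have zW: "z \<in> W" using lsub_smult[OF W(1)] w(1) by (simp add: z_def)
  have z: "snd (snd z) = 1" using w(2) by (simp add: z_def)
  have "W = affine_hull q (W \<inter> Hinf) z"
  proof (intro equalityI subsetI)
    fix a assume a: "a \<in> W"
    define l where "l = snd (snd a)"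
    have l: "l \<in> L" using a W(2) by (auto simp: l_def Vsig_iff)
    have "a - l \<cdot> z \<in> W \<inter> Hinf"
      using L.lsub_diff[OF W(1) a lsub_smult[OF W(1) l zW]] by (simp add: Hinf_iff z l_def)
    moreover have "a = (a - l \<cdot> z) + l \<cdot> z" by simp
    ultimately show "a \<in> affine_hull q (W \<inter> Hinf) z"
      using l by (metis affine_hullI)
  next
    fix a assume "a \<in> affine_hull q (W \<inter> Hinf) z"
    then show "a \<in> W"
      using lsub_add[OF W(1)] lsub_smult[OF W(1) _ zW] by (blast elim: affine_hullE)
  qed
  then show ?thesis using z by blast
qed

lemma affine_subspace_characterisation:
  "(\<exists>W. W \<subseteq> Vsig q \<and> subspace_dim L W (2 * k + 1) \<and> \<not> W \<subseteq> Hinf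
          \<and> A = aff_part q W \<and> meets_spread_uniformly (W \<inter> Hinf))
   \<longleftrightarrow> (\<exists>u\<in>Hinf. \<exists>v\<in>Hinf. \<exists>z. indep2 u v \<and> snd (snd z) = 1 \<and>
          A = (\<lambda>a. proj_pt L (a + z)) ` span2 K u v)" (is "(\<exists>W. ?P W) \<longleftrightarrow> ?R")
proof
  assume "\<exists>W. ?P W"
  then obtain W where W: "?P W" by blast
  then have sub: "lsub L W" by (simp add: L.subspace_dim_iff)
  obtain u v where uv: "u \<in> Hinf" "v \<in> Hinf" "indep2 u v" "W \<inter> Hinf = span2 K u v"
    using meets_spread_uniformly_iff[OF lsub_Int_Hinf[OF sub] Int_lower2] W by blast
  obtain z where z: "snd (snd z) = 1" "W = affine_hull q (W \<inter> Hinf) z"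
    using eq_affine_hull[OF sub] W by blast
  have "A = aff_part q W" using W by blast
  also have "\<dots> = (\<lambda>a. proj_pt L (a + z)) ` (W \<inter> Hinf)"
    using aff_part_affine_hull[OF lsub_Int_Hinf[OF sub] _ z(1)] z(2) by auto
  finally show ?R unfolding uv(4) using uv(1-3) z(1) by blast
next
  assume ?R
  then obtain u v z where uv: "u \<in> Hinf" "v \<in> Hinf" "indep2 u v" and z: "snd (snd z) = 1"
    and A: "A = (\<lambda>a. proj_pt L (a + z)) ` span2 K u v" by blast
  define M where "M = span2 K u v"
  have M: "lsub L M" unfolding M_def using K.lsub_span2 L_subset_K by (rule lsub_mono)
  have MH: "M \<subseteq> Hinf" using uv by (auto simp: M_def span2_def Hinf_iff)
  have "card M = q ^ (2 * k)"
    by (simp add: M_def card_span2[OF uv(3)] card_K power_mult[symmetric] mult.commute)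
  then have "subspace_dim L (affine_hull q M z) (2 * k + 1)"
    by (simp add: L.subspace_dim_iff card_L lsub_affine_hull[OF M MH z] card_affine_hull[OF M MH z])
  moreover have "meets_spread_uniformly M"
    using meets_spread_uniformly_iff[OF M MH] uv M_def by blast
  ultimately have "?P (affine_hull q M z)"
    using affine_hull_subset_Vsig[OF M MH z] affine_hull_not_subset_Hinf[OF M MH z]
    by (simp add: affine_hull_Int_Hinf[OF M MH z] aff_part_affine_hull[OF M MH z] A[folded M_def])
  then show "\<exists>W. ?P W" by blast
qed

lemma span3_Int_Hinf:
  assumes "u \<in> Hinf" "v \<in> Hinf" "snd (snd z) = 1"
  shows "span3 K u v z \<inter> Hinf = span2 K u v"
proof (intro equalityI subsetI)
  fix a assume a: "a \<in> span3 K u v z \<inter> Hinf"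
  then obtain s t w where "s \<in> K" "t \<in> K" "a = s \<cdot> u + t \<cdot> v + w \<cdot> z"
    by (auto simp: span3_def)
  moreover from this have "w = 0" using a assms by (simp add: Hinf_iff)
  ultimately show "a \<in> span2 K u v" by (auto simp: span2_def)
next
  fix a assume "a \<in> span2 K u v"
  then obtain s t where a: "s \<in> K" "t \<in> K" "a = s \<cdot> u + t \<cdot> v" by (auto simp: span2_def)
  then have "a \<in> span3 K u v z"
    unfolding span3_def by (intro image_eqI[of _ _ "(s, t, 0)"]) (auto simp: K.zero)
  then show "a \<in> span3 K u v z \<inter> Hinf" using a assms by (simp add: Hinf_iff)
qed

lemma proj_image_Int_linf:
  fixes S :: "'f vec3 set"
  shows "proj_pt UNIV ` (S - {0}) \<inter> linf = proj_pt UNIV ` (S \<inter> Hinf - {0})"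
  using proj_pt_in_linf_iff by (auto simp del: split_paired_All)

lemma proj_image_Int_plane_aff_pts:
  fixes S :: "'f vec3 set"
  shows "proj_pt UNIV ` (S - {0}) \<inter> plane_aff_pts = proj_pt UNIV ` (S - Hinf)"
proof -
  have "0 \<in> (Hinf :: 'f vec3 set)" by (simp add: Hinf_iff)
  then show ?thesis using proj_pt_in_plane_aff_pts_iff[where 'f = 'f] by blast
qed

lemma secant_iff:
  assumes "indep3 u v z"
  shows "secant q k (proj_pt UNIV ` (span3 K u v z - {0})) \<longleftrightarrow>
    card (span3 K u v z \<inter> Hinf) = (q ^ k) ^ 2"
proof -
  let ?M = "span3 K u v z \<inter> Hinf"
  have "card ?M = (q ^ k - 1) * card (proj_pt UNIV ` (?M - {0})) + 1"
  proof (rule card_quotient_by_scalars)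
    show "0 \<in> ?M" using lsub_0[OF K.lsub_span3] by (simp add: Hinf_iff)
    fix a assume "a \<in> ?M" "a \<noteq> 0"
    moreover from this have "coeffs_in ?M a = coeffs_in (span3 K u v z) a"
      by (auto simp: coeffs_in_def Hinf_iff)
    ultimately show "card (coeffs_in ?M a) = q ^ k"
      using K.coeffs_in_span3[OF assms] card_K by simp
  qed (rule proj_pt_UNIV_eq_iff)
  then show ?thesis
    unfolding secant_def proj_image_Int_linf using quadratic_count[OF qk_gt_1] by metis
qed

lemma phi_image_normal_form:
  assumes uv: "u \<in> Hinf" "v \<in> Hinf" and z: "snd (snd z) = 1"
  shows "phi q ` (proj_pt UNIV ` (span3 K u v z - {0}) \<inter> plane_aff_pts)
    = (\<lambda>a. proj_pt L (a + z)) ` span2 K u v" (is "?A = ?B")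
proof -
  have "?A = (\<lambda>a. proj_pt L ((1 / snd (snd a)) \<cdot> a)) ` (span3 K u v z - Hinf)"
    unfolding proj_image_Int_plane_aff_pts image_image
    by (rule image_cong) (simp_all add: phi_proj_pt)
  also have "\<dots> = ?B"
  proof (intro equalityI subsetI)
    fix P assume "P \<in> (\<lambda>a. proj_pt L ((1 / snd (snd a)) \<cdot> a)) ` (span3 K u v z - Hinf)"
    then obtain s t w where a: "s \<in> K" "t \<in> K" "w \<in> K" "s \<cdot> u + t \<cdot> v + w \<cdot> z \<notin> Hinf"
      and P: "P = proj_pt L ((1 / snd (snd (s \<cdot> u + t \<cdot> v + w \<cdot> z))) \<cdot> (s \<cdot> u + t \<cdot> v + w \<cdot> z))"
      by (blast elim: span3E)
    have w: "snd (snd (s \<cdot> u + t \<cdot> v + w \<cdot> z)) = w" using uv z by (simp add: Hinf_iff)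
    then have "w \<noteq> 0" using a(4) by (simp add: Hinf_iff)
    then have "P = proj_pt L (((s / w) \<cdot> u + (t / w) \<cdot> v) + z)"
      unfolding P w by (simp add: smult_add_right)
    moreover have "(s / w) \<cdot> u + (t / w) \<cdot> v \<in> span2 K u v"
      using a by (intro span2I K.divide)
    ultimately show "P \<in> ?B" by blast
  next
    fix P assume "P \<in> ?B"
    then obtain s t where st: "s \<in> K" "t \<in> K" "P = proj_pt L (s \<cdot> u + t \<cdot> v + z)"
      by (auto simp: span2_def)
    let ?a = "s \<cdot> u + t \<cdot> v + 1 \<cdot> z"
    have "?a \<in> span3 K u v z"
      unfolding span3_def using st K.one by (intro image_eqI[of _ _ "(s, t, 1)"]) auto
    moreover have 1: "snd (snd ?a) = 1" using uv z by (simp add: Hinf_iff)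
    moreover have "?a \<notin> Hinf" unfolding Hinf_iff 1 by simp
    moreover have "P = proj_pt L ((1 / snd (snd ?a)) \<cdot> ?a)" unfolding 1 using st by simp
    ultimately show "P \<in> (\<lambda>a. proj_pt L ((1 / snd (snd a)) \<cdot> a)) ` (span3 K u v z - Hinf)"
      by blast
  qed
  finally show ?thesis .
qed

lemma secant_subplane_iff:
  "subplane q k B \<and> secant q k B \<longleftrightarrow>
    (\<exists>u\<in>Hinf. \<exists>v\<in>Hinf. \<exists>z. indep2 u v \<and> snd (snd z) = 1 \<and>
      B = proj_pt UNIV ` (span3 K u v z - {0}))" (is "?lhs \<longleftrightarrow> ?rhs")
proof
  assume ?rhs
  then obtain u v z where uv: "u \<in> Hinf" "v \<in> Hinf" "indep2 u v" and z: "snd (snd z) = 1"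
    and B: "B = proj_pt UNIV ` (span3 K u v z - {0})" by blast
  have ind: "indep3 u v z"
    using uv z by (intro indep3I) (auto simp: Hinf_iff)
  then have "secant q k B"
    unfolding B secant_iff[OF ind] span3_Int_Hinf[OF uv(1,2) z] card_span2[OF uv(3)] card_K by simp
  then show ?lhs using ind B unfolding subplane_altdef by blast
next
  assume lhs: ?lhs
  then obtain u v z where ind: "indep3 u v z" and B: "B = proj_pt UNIV ` (span3 K u v z - {0})"
    unfolding subplane_altdef by blast
  define S where "S = span3 K u v z"
  define M where "M = S \<inter> Hinf"
  have S: "lsub K S" unfolding S_def by (rule K.lsub_span3)
  have M: "lsub K M" unfolding M_def using S by (rule lsub_Int_Hinf)
  have cM: "card M = (q ^ k) ^ 2"
    using lhs secant_iff[OF ind] by (simp add: B M_def S_def)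
  have "card (coeffs_in M a) = q ^ k" if "a \<in> M" "a \<noteq> 0" for a
  proof -
    have "coeffs_in M a = coeffs_in S a"
      using that by (auto simp: M_def coeffs_in_def Hinf_iff)
    then show ?thesis
      using that K.coeffs_in_span3[OF ind] card_K by (simp add: S_def M_def)
  qed
  then obtain u' v' where uv: "u' \<in> M" "v' \<in> M" "indep2 u' v'"
    using scattered_eq_span2[of M "q ^ k"] lsub_0[OF M] lsub_add[OF M] cM qk_gt_1 card_K by blast
  have cS: "card S = (q ^ k) ^ 3"
    by (simp add: S_def card_span3[OF ind] card_K)
  have "(q ^ k) ^ 2 \<noteq> (q ^ k) ^ 3" using qk_gt_1 by (subst power_inject_exp) auto
  then have "M \<noteq> S" using cM cS by auto
  then obtain z' where z': "z' \<in> S" "z' \<notin> Hinf" by (auto simp: M_def)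
  have ind': "indep3 u' v' z'"
    using uv z' by (intro indep3I) (auto simp: M_def)
  have S_eq: "S = span3 K u' v' z'"
  proof (rule sym, rule card_subset_eq)
    show "span3 K u' v' z' \<subseteq> S"
      using uv z' unfolding span3_def M_def
      by (auto intro!: lsub_add[OF S] lsub_smult[OF S] simp del: split_paired_All)
    show "card (span3 K u' v' z') = card S"
      by (simp add: cS card_span3[OF ind'] card_K)
  qed simp
  define c where "c = 1 / snd (snd z')"
  have c: "c \<noteq> 0" "c * snd (snd z') = 1" using z' by (auto simp: c_def Hinf_iff)
  have img: "span3 K (c \<cdot> u') (c \<cdot> v') (c \<cdot> z') = (\<lambda>a. c \<cdot> a) ` S"
    unfolding S_eq span3_def image_image
    by (rule image_cong) (auto simp: smult_add_right mult.commute)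
  have "inj (\<lambda>a. c \<cdot> a)"
    using c(1) by (intro inj_on_inverseI[of _ "\<lambda>a. (1 / c) \<cdot> a"]) simp
  then have "span3 K (c \<cdot> u') (c \<cdot> v') (c \<cdot> z') - {0} = (\<lambda>a. c \<cdot> a) ` (S - {0})"
    unfolding img by (simp add: image_set_diff)
  then have "proj_pt UNIV ` (span3 K (c \<cdot> u') (c \<cdot> v') (c \<cdot> z') - {0}) = B"
    using c(1) by (simp add: image_image UNIV.proj_pt_smult B S_def)
  moreover have "indep2 (c \<cdot> u') (c \<cdot> v')"
    using uv(3) c(1) by (simp add: indep2_def) (metis mult_eq_0_iff)
  moreover have "c \<cdot> u' \<in> Hinf" "c \<cdot> v' \<in> Hinf"
    using uv by (auto simp: M_def Hinf_iff)
  moreover have "snd (snd (c \<cdot> z')) = 1" using c by simp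
  ultimately show ?rhs by blast
qed

lemma secant_subplane_image_characterisation:
  "(\<exists>B. subplane q k B \<and> secant q k B \<and> A = phi q ` (B \<inter> plane_aff_pts))
   \<longleftrightarrow> (\<exists>u\<in>Hinf. \<exists>v\<in>Hinf. \<exists>z. indep2 u v \<and> snd (snd z) = 1 \<and>
          A = (\<lambda>a. proj_pt L (a + z)) ` span2 K u v)"
proof -
  have "(\<exists>B. subplane q k B \<and> secant q k B \<and> A = phi q ` (B \<inter> plane_aff_pts))
   \<longleftrightarrow> (\<exists>u\<in>Hinf. \<exists>v\<in>Hinf. \<exists>z. indep2 u v \<and> snd (snd z) = 1 \<and>
          A = phi q ` (proj_pt UNIV ` (span3 K u v z - {0}) \<inter> plane_aff_pts))"
    unfolding conj_assoc[symmetric] secant_subplane_iff by blast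
  then show ?thesis
    by (simp add: phi_image_normal_form cong: bex_cong conj_cong del: split_paired_Ex)
qed

end

theorem theorem3p1:
  fixes p m q n k :: nat and Pi :: "('f::{field,finite}) vec3 set set"
  assumes "prime p" and "m > 0" and "q = p ^ m" and "n \<ge> 1"
    and "card (UNIV :: 'f set) = q ^ n" and "k dvd n"
    and "Pi \<subseteq> sig_aff_pts q"
  shows "((\<exists>B. subplane q k B \<and> secant q k B \<and> Pi = phi q ` (B \<inter> plane_aff_pts))
      \<longleftrightarrow>
      (\<exists>W. W \<subseteq> Vsig q \<and> subspace_dim (subF q) W (2 * k + 1) \<and> \<not> W \<subseteq> Hinf
          \<and> Pi = aff_part q W
          \<and> subspace_dim (subF q) (W \<inter> Hinf) (2 * k)
          \<and> card {d \<in> Dk q n. d \<inter> pts (subF q) (W \<inter> Hinf) \<noteq> {}} = q ^ k + 1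
          \<and> (\<forall>d \<in> Dk q n. d \<inter> pts (subF q) (W \<inter> Hinf) \<noteq> {} \<longrightarrow>
               (\<exists>U. U \<subseteq> Vsig q \<and> subspace_dim (subF q) U k
                    \<and> pts (subF q) U = d \<inter> pts (subF q) (W \<inter> Hinf)))))
    \<and>
    (\<forall>W. W \<subseteq> Vsig q \<and> subspace_dim (subF q) W (2 * k + 1) \<and> \<not> W \<subseteq> Hinf
          \<and> Pi = aff_part q W
          \<and> subspace_dim (subF q) (W \<inter> Hinf) (2 * k)
          \<and> card {d \<in> Dk q n. d \<inter> pts (subF q) (W \<inter> Hinf) \<noteq> {}} = q ^ k + 1
          \<and> (\<forall>d \<in> Dk q n. d \<inter> pts (subF q) (W \<inter> Hinf) \<noteq> {} \<longrightarrow>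
               (\<exists>U. U \<subseteq> Vsig q \<and> subspace_dim (subF q) U k
                    \<and> pts (subF q) U = d \<inter> pts (subF q) (W \<inter> Hinf)))
      \<longrightarrow> (\<forall>d \<in> Dk q n. d \<inter> pts (subF q) (W \<inter> Hinf) \<noteq> {} \<longrightarrow>
               d \<inter> pts (subF q) (W \<inter> Hinf) \<in> Dk q k))"
proof -
  interpret subfield_tower p m q n k "TYPE('f)"
    using assms by unfold_locales
  show ?thesis
  proof (intro conjI allI impI ballI, goal_cases)
    case 1
    show ?case
      unfolding secant_subplane_image_characterisation
      unfolding affine_subspace_characterisation[symmetric] meets_spread_uniformly_def ..
  next
    case (2 W d)
    then have "lsub (subF q) (W \<inter> Hinf)" by (simp add: L.subspace_dim_iff)
    moreover have "meets_spread_uniformly (W \<inter> Hinf)"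
      unfolding meets_spread_uniformly_def using 2(1) by (elim conjE) (intro conjI)
    ultimately obtain u v where "indep2 u v" "W \<inter> Hinf = span2 K u v"
      using meets_spread_uniformly_iff[OF _ Int_lower2] by blast
    then show ?case using spread_elt_Int_span2[of u v d] 2(2,3) by (metis Int_lower2)
  qed
qed

end
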